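(* Assume there is a dynamic algorithm $\mathcal A$ that maintains a maximal independent set in an initially empty $n$-vertex graph undergoing a sequence of $m$ edge insertions and deletions in total update time $T(n,m)$. Then there is a dynamic algorithm $\mathcal B$ that maintains a maximal clique in an $n$-vertex graph with $m$ initial edges undergoing a sequence of edge deletions in total update time $O(T(n,O(m)))$. Moreover, if $\mathcal A$ is robust against adaptive adversaries, then so is $\mathcal B$.
   Context: All graphs are undirected and unweighted. A maximal independent set is an independent set $I$ such that $I\cup\{x\}$ is not independent for any vertex $x\notin I$; a maximal clique is a clique not contained in any larger clique. A dynamic algorithm outputs the maintained object after each update; total update time is the total running time including initialization. An algorithm is robust against adaptive adversaries if its guarantees hold even when each next update may depend on the algorithm's previous outputs. *)

theory Defs
  imports "HOL-Probability.Probability" "HOL-Library.Ramsey"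
begin

section \<open>Graphs\<close>

text \<open>An \<open>n\<close>-vertex graph has vertex set \<open>{..<n}\<close> and a set of two-element subsets of it as edge set.
  The predicates \<^const>\<open>clique\<close> and \<^const>\<open>indep\<close> are those of \<^theory>\<open>HOL-Library.Ramsey\<close>.\<close>

definition maximal_indep :: "nat \<Rightarrow> nat set set \<Rightarrow> nat set \<Rightarrow> bool" where
  "maximal_indep n E I \<longleftrightarrow>
     I \<subseteq> {..<n} \<and> indep I E \<and> (\<forall>x\<in>{..<n} - I. \<not> indep (I \<union> {x}) E)"

definition maximal_clique :: "nat \<Rightarrow> nat set set \<Rightarrow> nat set \<Rightarrow> bool" where
  "maximal_clique n E K \<longleftrightarrow>
     K \<subseteq> {..<n} \<and> clique K E \<and> (\<forall>K'. K \<subset> K' \<and> K' \<subseteq> {..<n} \<longrightarrow> \<not> clique K' E)"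

text \<open>Initial edges are given to an algorithm as a list, in arbitrary order and orientation and
  without repetition, so that the length of the list is the number of edges.\<close>

definition edges :: "(nat \<times> nat) list \<Rightarrow> nat set set" where
  "edges es = (\<lambda>(u, v). {u, v}) ` set es"

definition edge_list :: "nat \<Rightarrow> (nat \<times> nat) list \<Rightarrow> bool" where
  "edge_list n es \<longleftrightarrow>
     (\<forall>(u, v)\<in>set es. u < n \<and> v < n \<and> u \<noteq> v) \<and> distinct (map (\<lambda>(u, v). {u, v}) es)"

datatype update = Insert nat nat | Delete nat nat

fun apply_update :: "update \<Rightarrow> nat set set \<Rightarrow> nat set set" where
  "apply_update (Insert u v) E = E \<union> {{u, v}}"
| "apply_update (Delete u v) E = E - {{u, v}}"

fun legal_update :: "nat \<Rightarrow> nat set set \<Rightarrow> update \<Rightarrow> bool" where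
  "legal_update n E (Insert u v) \<longleftrightarrow> u < n \<and> v < n \<and> u \<noteq> v \<and> {u, v} \<notin> E"
| "legal_update n E (Delete u v) \<longleftrightarrow> {u, v} \<in> E"

section \<open>Randomized word RAM\<close>

text \<open>Running time is the number of steps on a word RAM with \<open>w\<close>-bit words. A program has finitely many
  registers and finitely many arrays, each array having one cell per \<open>w\<close>-bit address; all are
  zero initially. Arithmetic is modulo \<open>2 ^ w\<close>. The instruction \<open>Rand\<close> draws a fresh uniformly
  random word, taken from the tape \<open>tape\<close>. Every operator node of an expression and every
  instruction costs one step.\<close>

datatype binop = Add | Sub | Mul | Div | Mod | And | Or | Xor | Shl | Shr | Eq | Less

fun binop_val :: "nat \<Rightarrow> binop \<Rightarrow> nat \<Rightarrow> nat \<Rightarrow> nat" where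
  "binop_val w Add a b = (a + b) mod 2 ^ w"
| "binop_val w Sub a b = (2 ^ w + a - b) mod 2 ^ w"
| "binop_val w Mul a b = (a * b) mod 2 ^ w"
| "binop_val w Div a b = a div b"
| "binop_val w Mod a b = a mod b"
| "binop_val w And a b = Bit_Operations.and a b"
| "binop_val w Or a b = Bit_Operations.or a b"
| "binop_val w Xor a b = Bit_Operations.xor a b"
| "binop_val w Shl a b = push_bit b a mod 2 ^ w"
| "binop_val w Shr a b = drop_bit b a"
| "binop_val w Eq a b = of_bool (a = b) mod 2 ^ w"
| "binop_val w Less a b = of_bool (a < b) mod 2 ^ w"

datatype exp =
    Const nat
  | Reg nat
  | Read nat exp  \<comment> \<open>array name, index\<close>
  | Op binop exp exp

datatype com =
    Skip
  | Assign nat exp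
  | Store nat exp exp  \<comment> \<open>array name, index, value\<close>
  | Rand nat
  | Seq com com
  | If exp com com
  | While exp com

record state =
  regs :: "nat \<Rightarrow> nat"
  arrs :: "nat \<Rightarrow> nat \<Rightarrow> nat"
  tape :: "nat stream"

fun val :: "nat \<Rightarrow> exp \<Rightarrow> state \<Rightarrow> nat" where
  "val w (Const c) s = c mod 2 ^ w"
| "val w (Reg r) s = regs s r"
| "val w (Read a e) s = arrs s a (val w e s)"
| "val w (Op f e1 e2) s = binop_val w f (val w e1 s) (val w e2 s)"

fun cost :: "exp \<Rightarrow> nat" where
  "cost (Const c) = 1"
| "cost (Reg r) = 1"
| "cost (Read a e) = cost e + 1"
| "cost (Op f e1 e2) = cost e1 + cost e2 + 1"

definition set_reg :: "nat \<Rightarrow> nat \<Rightarrow> state \<Rightarrow> state" where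
  "set_reg r x s = s\<lparr>regs := (regs s)(r := x)\<rparr>"

definition set_cell :: "nat \<Rightarrow> nat \<Rightarrow> nat \<Rightarrow> state \<Rightarrow> state" where
  "set_cell a i x s = s\<lparr>arrs := (arrs s)(a := (arrs s a)(i := x))\<rparr>"

text \<open>\<open>exec w c s t s'\<close>: started in \<open>s\<close>, the program \<open>c\<close> halts in \<open>s'\<close> after \<open>t\<close> steps.\<close>

inductive exec :: "nat \<Rightarrow> com \<Rightarrow> state \<Rightarrow> nat \<Rightarrow> state \<Rightarrow> bool" for w :: nat where
  Skip: "exec w Skip s 1 s"
| Assign: "exec w (Assign r e) s (cost e + 1) (set_reg r (val w e s) s)"
| Store: "exec w (Store a e1 e2) s (cost e1 + cost e2 + 1) (set_cell a (val w e1 s) (val w e2 s) s)"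
| Rand: "exec w (Rand r) s 1 ((set_reg r (shd (tape s)) s)\<lparr>tape := stl (tape s)\<rparr>)"
| Seq: "exec w c1 s t1 s1 \<Longrightarrow> exec w c2 s1 t2 s2 \<Longrightarrow> exec w (Seq c1 c2) s (t1 + t2) s2"
| IfTrue: "val w e s \<noteq> 0 \<Longrightarrow> exec w c1 s t s' \<Longrightarrow> exec w (If e c1 c2) s (cost e + 1 + t) s'"
| IfFalse: "val w e s = 0 \<Longrightarrow> exec w c2 s t s' \<Longrightarrow> exec w (If e c1 c2) s (cost e + 1 + t) s'"
| WhileFalse: "val w e s = 0 \<Longrightarrow> exec w (While e c) s (cost e + 1) s"
| WhileTrue: "val w e s \<noteq> 0 \<Longrightarrow> exec w c s t1 s1 \<Longrightarrow> exec w (While e c) s1 t2 s2 \<Longrightarrow>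
    exec w (While e c) s (cost e + 1 + t1 + t2) s2"

definition random_tape :: "nat \<Rightarrow> nat stream measure" where
  "random_tape w = stream_space (measure_pmf (pmf_of_set {..<2 ^ w}))"

section \<open>Dynamic algorithms\<close>

text \<open>The first program is run once on the initial graph, the second one once after each update; the
  memory persists in between.\<close>

datatype dynamic_algorithm = Dynamic_Algorithm (init_prog: com) (update_prog: com)

text \<open>Input convention: the number of vertices is in register 0, the number of initial edges in
  register 1, and the endpoints of the \<open>i\<close>-th initial edge are in cell \<open>i\<close> of arrays 1 and 2.\<close>

definition initial_state :: "nat \<Rightarrow> (nat \<times> nat) list \<Rightarrow> nat stream \<Rightarrow> state" where
  "initial_state n es \<omega> =
     \<lparr>regs = (\<lambda>_. 0)(0 := n, 1 := length es),
      arrs = (\<lambda>_ _. 0)(1 := (\<lambda>i. if i < length es then fst (es ! i) else 0),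
                       2 := (\<lambda>i. if i < length es then snd (es ! i) else 0)),
      tape = \<omega>\<rparr>"

text \<open>An update is passed in registers 0 (1 for an insertion, 0 for a deletion), 1 and 2 (endpoints).\<close>

fun pass_update :: "update \<Rightarrow> state \<Rightarrow> state" where
  "pass_update (Insert u v) s = set_reg 0 1 (set_reg 1 u (set_reg 2 v s))"
| "pass_update (Delete u v) s = set_reg 0 0 (set_reg 1 u (set_reg 2 v s))"

text \<open>Output convention: array 0 holds the characteristic vector of the maintained vertex set.\<close>

definition output_set :: "nat \<Rightarrow> state \<Rightarrow> nat set" where
  "output_set n s = {v \<in> {..<n}. arrs s 0 v \<noteq> 0}"

text \<open>An adversary chooses the next update from the list of all outputs so far, the output for the initial
  graph coming first. (Its own earlier updates are determined by these outputs as well.) The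
  adversary is oblivious if its choice depends on the number of the round only, i.e. if it is a
  fixed update sequence.\<close>

type_synonym adversary = "nat set list \<Rightarrow> update"

datatype adversary_kind = Oblivious | Adaptive

fun of_kind :: "adversary_kind \<Rightarrow> adversary \<Rightarrow> bool" where
  "of_kind Oblivious \<sigma> \<longleftrightarrow> (\<forall>os os'. length os = length os' \<longrightarrow> \<sigma> os = \<sigma> os')"
| "of_kind Adaptive \<sigma> \<longleftrightarrow> True"

text \<open>\<open>graph_at \<sigma> E os i\<close> is the edge set after the first \<open>i\<close> updates if the outputs are \<open>os\<close>.\<close>

fun graph_at :: "adversary \<Rightarrow> nat set set \<Rightarrow> nat set list \<Rightarrow> nat \<Rightarrow> nat set set" where
  "graph_at \<sigma> E os 0 = E"
| "graph_at \<sigma> E os (Suc i) = apply_update (\<sigma> (take (Suc i) os)) (graph_at \<sigma> E os i)"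

text \<open>The first \<open>k\<close> updates of \<open>\<sigma>\<close> are from \<open>U\<close> and legal, whatever the outputs are.\<close>

definition legal_adversary ::
    "update set \<Rightarrow> nat \<Rightarrow> nat set set \<Rightarrow> nat \<Rightarrow> adversary \<Rightarrow> bool" where
  "legal_adversary U n E k \<sigma> \<longleftrightarrow>
     (\<forall>os. 0 < length os \<and> length os \<le> k \<longrightarrow>
        \<sigma> os \<in> U \<and> legal_update n (graph_at \<sigma> E os (length os - 1)) (\<sigma> os))"

text \<open>\<open>run w A n es \<sigma> \<omega> t s os\<close>: with random words \<open>\<omega>\<close>, \<open>A\<close> playing against \<open>\<sigma>\<close> produces the outputs
  \<open>os\<close> (after initialization and after each of \<open>length os - 1\<close> updates) and then is in state \<open>s\<close>,
  having made \<open>t\<close> steps altogether, initialization included.\<close>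

inductive run :: "nat \<Rightarrow> dynamic_algorithm \<Rightarrow> nat \<Rightarrow> (nat \<times> nat) list \<Rightarrow> adversary \<Rightarrow> nat stream \<Rightarrow>
    nat \<Rightarrow> state \<Rightarrow> nat set list \<Rightarrow> bool"
  for w A n es \<sigma> \<omega> where
  init: "exec w (init_prog A) (initial_state n es \<omega>) t s \<Longrightarrow> run w A n es \<sigma> \<omega> t s [output_set n s]"
| step: "run w A n es \<sigma> \<omega> t s os \<Longrightarrow> exec w (update_prog A) (pass_update (\<sigma> os) s) t' s' \<Longrightarrow>
    run w A n es \<sigma> \<omega> (t + t') s' (os @ [output_set n s'])"

text \<open>\<open>correct_run P w A n es \<sigma> \<omega> k t\<close>: initialization and the first \<open>k\<close> updates take \<open>t\<close> steps in
  total, and each output has property \<open>P\<close> with respect to the then current graph.\<close>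

definition correct_run :: "(nat \<Rightarrow> nat set set \<Rightarrow> nat set \<Rightarrow> bool) \<Rightarrow>
    nat \<Rightarrow> dynamic_algorithm \<Rightarrow> nat \<Rightarrow> (nat \<times> nat) list \<Rightarrow> adversary \<Rightarrow> nat stream \<Rightarrow> nat \<Rightarrow> nat \<Rightarrow> bool"
  where
  "correct_run P w A n es \<sigma> \<omega> k t \<longleftrightarrow>
     (\<exists>s os. run w A n es \<sigma> \<omega> t s os \<and> length os = Suc k \<and>
        (\<forall>i\<le>k. P n (graph_at \<sigma> (edges es) os i) (os ! i)))"

text \<open>As execution is deterministic for a fixed tape, the following set has at most one element; it is
  empty, and the total time infinite, if a program diverges.\<close>

definition total_time :: "nat \<Rightarrow> dynamic_algorithm \<Rightarrow> nat \<Rightarrow> (nat \<times> nat) list \<Rightarrow> adversary \<Rightarrow>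
    nat stream \<Rightarrow> nat \<Rightarrow> ennreal" where
  "total_time w A n es \<sigma> \<omega> k =
     Inf {of_nat t | t. \<exists>s os. run w A n es \<sigma> \<omega> t s os \<and> length os = Suc k}"

text \<open>The usual kinds of guarantees. \<open>Worst_case\<close>: correctness and time bound hold for all random choices
  (in particular this is the notion for deterministic algorithms). \<open>Expected\<close>: the outputs
  are correct (almost surely), and the bound is on the expected total time.
  \<open>With_failure p\<close>: with probability at least \<open>1 - p n\<close>, all outputs are correct and the time
  bound holds.\<close>

datatype guarantee = Worst_case | Expected | With_failure "nat \<Rightarrow> real"

fun meets :: "guarantee \<Rightarrow> (nat \<Rightarrow> nat set set \<Rightarrow> nat set \<Rightarrow> bool) \<Rightarrow>
    nat \<Rightarrow> dynamic_algorithm \<Rightarrow> nat \<Rightarrow> (nat \<times> nat) list \<Rightarrow> adversary \<Rightarrow> nat \<Rightarrow> real \<Rightarrow> bool" where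
  "meets Worst_case P w A n es \<sigma> k b \<longleftrightarrow>
     (\<forall>\<omega>\<in>streams {..<2 ^ w}. \<exists>t. correct_run P w A n es \<sigma> \<omega> k t \<and> real t \<le> b)"
| "meets Expected P w A n es \<sigma> k b \<longleftrightarrow>
     (AE \<omega> in random_tape w. \<exists>t. correct_run P w A n es \<sigma> \<omega> k t) \<and>
     (\<integral>\<^sup>+\<omega>. total_time w A n es \<sigma> \<omega> k \<partial>random_tape w) \<le> ennreal b"
| "meets (With_failure p) P w A n es \<sigma> k b \<longleftrightarrow>
     (\<exists>S\<in>sets (random_tape w). measure (random_tape w) S \<ge> 1 - p n \<and>
        (\<forall>\<omega>\<in>S. \<exists>t. correct_run P w A n es \<sigma> \<omega> k t \<and> real t \<le> b))"

text \<open>The word length is at least \<open>\<kappa> \<cdot> log (n + m + 2)\<close> for a constant \<open>\<kappa>\<close> depending on the algorithm,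
  and the time bound must not depend on the word length otherwise.

  \<open>maintains_MIS\<close>: fully dynamic, from the empty graph, with \<open>m\<close> the number of updates.
  \<open>maintains_max_clique\<close>: decremental, with \<open>m\<close> the number of initial edges and an arbitrary number
  \<open>k\<close> of deletions (legality forces \<open>k \<le> m\<close>).\<close>

definition maintains_MIS ::
    "adversary_kind \<Rightarrow> guarantee \<Rightarrow> dynamic_algorithm \<Rightarrow> (nat \<Rightarrow> nat \<Rightarrow> real) \<Rightarrow> bool" where
  "maintains_MIS a g A T \<longleftrightarrow>
     (\<exists>\<kappa>::nat. \<forall>w n m \<sigma>. (n + m + 2) ^ \<kappa> \<le> 2 ^ w \<and> of_kind a \<sigma> \<and>
        legal_adversary UNIV n {} m \<sigma> \<longrightarrow>
        meets g maximal_indep w A n [] \<sigma> m (T n m))"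

definition maintains_max_clique ::
    "adversary_kind \<Rightarrow> guarantee \<Rightarrow> dynamic_algorithm \<Rightarrow> (nat \<Rightarrow> nat \<Rightarrow> real) \<Rightarrow> bool" where
  "maintains_max_clique a g B T \<longleftrightarrow>
     (\<exists>\<kappa>::nat. \<forall>w n m es k \<sigma>. (n + m + 2) ^ \<kappa> \<le> 2 ^ w \<and> edge_list n es \<and> length es = m \<and>
        of_kind a \<sigma> \<and> legal_adversary {Delete u v | u v. True} n (edges es) k \<sigma> \<longrightarrow>
        meets g maximal_clique w B n es \<sigma> k (T n m))"

text \<open>The guarantees of the algorithm hold against adaptive adversaries, too.\<close>

abbreviation robust_MIS :: "guarantee \<Rightarrow> dynamic_algorithm \<Rightarrow> (nat \<Rightarrow> nat \<Rightarrow> real) \<Rightarrow> bool" where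
  "robust_MIS \<equiv> maintains_MIS Adaptive"

abbreviation robust_max_clique :: "guarantee \<Rightarrow> dynamic_algorithm \<Rightarrow> (nat \<Rightarrow> nat \<Rightarrow> real) \<Rightarrow> bool" where
  "robust_max_clique \<equiv> maintains_max_clique Adaptive"

end

(* Let v be a vertex of degree d with d (d + 1) <= 2 m in the initial graph G; it is found in O(m)
   steps. A maximal clique of G containing v is the intersection of N[v] with a maximal independent
   set of the graph H on the same n vertices whose edges are the non-adjacent pairs inside N(v).
   Algorithm B runs A on H. Initially at most d^2 <= 2 m edges are inserted into H. Deleting an edge
   inside N(v) inserts one edge into H, and deleting an edge at v isolates a vertex of H by at most
   d edge deletions, which happens at most d times. So A receives at most 5 m updates.

   The adversary that A faces replays B on the outputs of A, so it is oblivious if the adversary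
   of B is. B draws random words only within A, so both use the same tape, and all bounds are
   proved for each tape separately. *)

theory Submission
  imports Defs
begin

section \<open>Execution\<close>

text \<open>Such a vertex exists because, for \<open>n > 0\<close>, a vertex of minimum degree
  \<open>d < n\<close> gives \<open>d (d + 1) <= n d <= 2 m\<close>. Since \<open>n\<close> may be
  far larger than \<open>m\<close>, no step may touch all \<open>n\<close> cells: the first suitable
  vertex has index at most \<open>2 m\<close>, the zeroed adjacency matrix is written only at edges,
  and the clique is never recomputed but mirrored at each output write of the guest. The assumed
  bound is for an exact number of updates and \<open>T\<close> need not be monotone, so the analysed
  guest run is padded to exactly \<open>5 m\<close> updates; the host itself never executes the
  padding. Every guest call takes at least one step, hence the guest's time exceeds
  \<open>5 m\<close> and pays for the O(m) overhead of the host. The simulated adversary must be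
  legal against every list of outputs, even one containing no independent set at all; therefore the
  replay is defined for arbitrary outputs, and H is tracked without using any property of
  them.\<close>

definition wp :: "nat \<Rightarrow> com \<Rightarrow> (nat \<Rightarrow> state \<Rightarrow> bool) \<Rightarrow> nat \<Rightarrow> state \<Rightarrow> bool" where
  "wp w c Q t s \<longleftrightarrow> (\<exists>t' s'. exec w c s t' s' \<and> Q (t + t') s')"

inductive_cases exec_SkipE: "exec w Skip s t s'"
inductive_cases exec_AssignE: "exec w (Assign r e) s t s'"
inductive_cases exec_StoreE: "exec w (Store a e1 e2) s t s'"
inductive_cases exec_SeqE: "exec w (Seq c1 c2) s t s'"
inductive_cases exec_IfE: "exec w (If e c1 c2) s t s'"

lemma wpI: "exec w c s t' s' \<Longrightarrow> Q (t + t') s' \<Longrightarrow> wp w c Q t s"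
  unfolding wp_def by blast

lemma wpE:
  assumes "wp w c Q t s"
  obtains t' s' where "exec w c s t' s'" "Q (t + t') s'"
  using assms unfolding wp_def by blast

lemma wp_Skip [simp]: "wp w Skip Q t s \<longleftrightarrow> Q (t + 1) s"
  by (auto elim!: wpE exec_SkipE intro: wpI exec.Skip)

lemma wp_Assign [simp]:
  "wp w (Assign r e) Q t s \<longleftrightarrow> Q (t + (cost e + 1)) (set_reg r (val w e s) s)"
  by (auto elim!: wpE exec_AssignE intro: wpI[OF exec.Assign])

lemma wp_Store [simp]:
  "wp w (Store a e1 e2) Q t s \<longleftrightarrow>
     Q (t + (cost e1 + cost e2 + 1)) (set_cell a (val w e1 s) (val w e2 s) s)"
  by (auto elim!: wpE exec_StoreE intro: wpI[OF exec.Store])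

text \<open>The clock \<open>t\<close> counts from the start of the whole program, so sequencing is
  plain nesting of postconditions and no costs have to be split.\<close>

lemma wp_Seq [simp]: "wp w (Seq c1 c2) Q t s \<longleftrightarrow> wp w c1 (wp w c2 Q) t s"
proof
  assume "wp w (Seq c1 c2) Q t s"
  then obtain t' s' where "exec w (Seq c1 c2) s t' s'" and Q: "Q (t + t') s'" by (rule wpE)
  then obtain t1 s1 t2 where "exec w c1 s t1 s1" "exec w c2 s1 t2 s'" "t' = t1 + t2"
    by (elim exec_SeqE) blast
  with Q show "wp w c1 (wp w c2 Q) t s"
    by (intro wpI[of w c1 s t1 s1] wpI[of w c2 s1 t2 s']) (simp_all add: add.assoc)
next
  assume "wp w c1 (wp w c2 Q) t s"
  then obtain t1 s1 t2 s2 where "exec w c1 s t1 s1" "exec w c2 s1 t2 s2" "Q (t + t1 + t2) s2"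
    by (elim wpE)
  then show "wp w (Seq c1 c2) Q t s"
    by (intro wpI[OF exec.Seq]) (simp_all add: add.assoc)
qed

lemma wp_If [simp]:
  "wp w (If e c1 c2) Q t s \<longleftrightarrow>
     (if val w e s \<noteq> 0 then wp w c1 Q (t + (cost e + 1)) s else wp w c2 Q (t + (cost e + 1)) s)"
  (is "_ \<longleftrightarrow> ?r")
proof
  assume "wp w (If e c1 c2) Q t s"
  then obtain t' s' where "exec w (If e c1 c2) s t' s'" and Q: "Q (t + t') s'" by (rule wpE)
  then show ?r
    by (elim exec_IfE) (auto intro!: wpI simp: add.assoc)
next
  assume r: ?r
  show "wp w (If e c1 c2) Q t s"
  proof (cases "val w e s = 0")
    case True
    with r obtain t' s' where "exec w c2 s t' s'" "Q (t + (cost e + 1) + t') s'"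
      by (auto elim: wpE)
    with True show ?thesis
      by (intro wpI[OF exec.IfFalse]) (simp_all add: add.assoc)
  next
    case False
    with r obtain t' s' where "exec w c1 s t' s'" "Q (t + (cost e + 1) + t') s'"
      by (auto elim: wpE)
    with False show ?thesis
      by (intro wpI[OF exec.IfTrue]) (simp_all add: add.assoc)
  qed
qed

text \<open>All loops of the host are counted, so the number \<open>N\<close> of rounds is given in
  advance and indexes the invariant; the induction runs down from \<open>N\<close>, and termination
  needs no separate variant.\<close>

lemma wp_While:
  assumes "I 0 t s"
    and "\<And>i t s. i < N \<Longrightarrow> I i t s \<Longrightarrow> val w e s \<noteq> 0 \<and> wp w c (I (Suc i)) (t + (cost e + 1)) s"
    and "\<And>t s. I N t s \<Longrightarrow> val w e s = 0 \<and> Q (t + (cost e + 1)) s"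
  shows "wp w (While e c) Q t s"
proof -
  have "wp w (While e c) Q t s" if "i \<le> N" "I i t s" for i t s
    using that
  proof (induction i arbitrary: t s rule: inc_induct)
    case base
    with assms(3) show ?case by (intro wpI[OF exec.WhileFalse]) auto
  next
    case (step i)
    with assms(2) have e: "val w e s \<noteq> 0" and "wp w c (I (Suc i)) (t + (cost e + 1)) s" by auto
    then obtain t1 s1 where 1: "exec w c s t1 s1" "I (Suc i) (t + (cost e + 1) + t1) s1"
      unfolding wp_def by blast
    then obtain t2 s2 where 2: "exec w (While e c) s1 t2 s2" "Q (t + (cost e + 1) + t1 + t2) s2"
      using step.IH unfolding wp_def by blast
    from 2(2) show ?case
      by (intro wpI[OF exec.WhileTrue[OF e 1(1) 2(1)]]) (simp add: add.assoc)
  qed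
  with assms(1) show ?thesis by blast
qed

lemma regs_set [simp]:
  "regs (set_reg r x s) = (regs s)(r := x)" "arrs (set_reg r x s) = arrs s"
  "tape (set_reg r x s) = tape s" "regs (set_cell a i x s) = regs s"
  "arrs (set_cell a i x s) = (arrs s)(a := (arrs s a)(i := x))" "tape (set_cell a i x s) = tape s"
  by (simp_all add: set_reg_def set_cell_def)

lemma exec_pos: "exec w c s t s' \<Longrightarrow> t > 0"
  by (induction rule: exec.induct) auto

lemma cost_pos: "cost e > 0"
  by (induction e) auto

section \<open>Running a program inside a larger one\<close>

text \<open>The guest owns the registers and arrays from 16 on. Its output vector is array 16; the host's
  array 0 is kept equal to it, masked by the host's array 4. Registers 14 and 15 are scratch.\<close>

fun embed_exp :: "exp \<Rightarrow> exp" where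
  "embed_exp (Const c) = Const c"
| "embed_exp (Reg r) = Reg (r + 16)"
| "embed_exp (Read a e) = Read (a + 16) (embed_exp e)"
| "embed_exp (Op f e1 e2) = Op f (embed_exp e1) (embed_exp e2)"

text \<open>A write to the guest's output is mirrored at once, because rebuilding the output vector
  after each update would cost \<open>n\<close> steps. Index and value are first put into scratch
  registers so that neither expression is evaluated twice, which keeps the slowdown
  constant.\<close>

fun embed_com :: "com \<Rightarrow> com" where
  "embed_com Skip = Skip"
| "embed_com (Assign r e) = Assign (r + 16) (embed_exp e)"
| "embed_com (Store a e1 e2) =
     (if a = 0 then
        Seq (Assign 14 (embed_exp e1)) (Seq (Assign 15 (embed_exp e2)) (Seq (Store 16 (Reg 14) (Reg 15))
          (If (Reg 15) (Store 0 (Reg 14) (Read 4 (Reg 14))) (Store 0 (Reg 14) (Const 0)))))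
      else Store (a + 16) (embed_exp e1) (embed_exp e2))"
| "embed_com (Rand r) = Rand (r + 16)"
| "embed_com (Seq c1 c2) = Seq (embed_com c1) (embed_com c2)"
| "embed_com (If e c1 c2) = If (embed_exp e) (embed_com c1) (embed_com c2)"
| "embed_com (While e c) = While (embed_exp e) (embed_com c)"

definition emb :: "state \<Rightarrow> state \<Rightarrow> bool" where
  "emb a s \<longleftrightarrow> (\<forall>r. regs s (r + 16) = regs a r) \<and> (\<forall>x. arrs s (x + 16) = arrs a x) \<and>
     tape s = tape a \<and> (\<forall>i. arrs s 0 i = (if arrs a 0 i \<noteq> 0 then arrs s 4 i else 0))"

text \<open>The range stops before the scratch registers 14 and 15, and array 0 is left out because
  it mirrors the guest's output.\<close>

definition host_eq :: "state \<Rightarrow> state \<Rightarrow> bool" where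
  "host_eq s s' \<longleftrightarrow> (\<forall>r<14. regs s' r = regs s r) \<and> (\<forall>x. 0 < x \<and> x < 16 \<longrightarrow> arrs s' x = arrs s x)"

lemma host_eq_refl: "host_eq s s"
  by (simp add: host_eq_def)

lemma host_eq_trans: "host_eq s s1 \<Longrightarrow> host_eq s1 s2 \<Longrightarrow> host_eq s s2"
  by (simp add: host_eq_def)

lemma cost_embed [simp]: "cost (embed_exp e) = cost e"
  by (induction e) auto

lemma val_embed: "emb a s \<Longrightarrow> val w (embed_exp e) s = val w e a"
  by (induction e) (auto simp: emb_def)

lemma val_embed_cong:
  "(\<forall>r\<ge>16. regs s' r = regs s r) \<Longrightarrow> arrs s' = arrs s \<Longrightarrow> val w (embed_exp e) s' = val w (embed_exp e) s"
  by (induction e) auto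

text \<open>Only an output write gets slower: it takes at most \<open>cost e1 + cost e2 + 11\<close>
  instead of \<open>cost e1 + cost e2 + 1\<close> steps. As both costs are at least 1, a factor of 5
  suffices.\<close>

lemma exec_embed:
  assumes "exec w c a t a'" "emb a s"
  shows "\<exists>t' s'. exec w (embed_com c) s t' s' \<and> t' \<le> 5 * t \<and> emb a' s' \<and> host_eq s s'"
  using assms
proof (induction arbitrary: s)
  case (Skip a)
  then show ?case using exec.Skip host_eq_refl by fastforce
next
  case (Assign r e a)
  have "emb (set_reg r (val w e a) a) (set_reg (r + 16) (val w (embed_exp e) s) s)"
    using Assign by (auto simp: emb_def val_embed)
  moreover have "host_eq s (set_reg (r + 16) (val w (embed_exp e) s) s)"
    by (auto simp: host_eq_def)
  ultimately show ?case
    using exec.Assign[of w "r + 16" "embed_exp e" s] by fastforce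
next
  case (Store x e1 e2 a)
  have v: "val w (embed_exp e1) s = val w e1 a" "val w (embed_exp e2) s = val w e2 a"
    using Store by (auto simp: val_embed)
  show ?case
  proof (cases "x = 0")
    case False
    have "emb (set_cell x (val w e1 a) (val w e2 a) a)
        (set_cell (x + 16) (val w (embed_exp e1) s) (val w (embed_exp e2) s) s)"
      using Store False by (auto simp: emb_def v)
    moreover have "host_eq s (set_cell (x + 16) (val w (embed_exp e1) s) (val w (embed_exp e2) s) s)"
      by (auto simp: host_eq_def)
    ultimately show ?thesis
      using False exec.Store[of w "x + 16" "embed_exp e1" "embed_exp e2" s] by fastforce
  next
    case True
    have c: "cost e1 > 0" "cost e2 > 0" by (rule cost_pos)+
    have "arrs s 16 = arrs a 0"
      using Store by (metis emb_def add_0)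
    have v2: "val w (embed_exp e2) (set_reg 14 y s) = val w e2 a" for y
      using val_embed_cong[of "set_reg 14 y s" s w e2] v by simp
    have "wp w (embed_com (Store 0 e1 e2)) (\<lambda>t' s'. t' \<le> 5 * (cost e1 + cost e2 + 1) \<and>
        emb (set_cell 0 (val w e1 a) (val w e2 a) a) s' \<and> host_eq s s') 0 s"
      using Store c \<open>arrs s 16 = arrs a 0\<close> by (auto simp: v v2 emb_def host_eq_def)
    with True show ?thesis unfolding wp_def by auto
  qed
next
  case (Rand r a)
  let ?s = "(set_reg (r + 16) (shd (tape s)) s)\<lparr>tape := stl (tape s)\<rparr>"
  have "emb ((set_reg r (shd (tape a)) a)\<lparr>tape := stl (tape a)\<rparr>) ?s"
    using Rand by (auto simp: emb_def)
  moreover have "host_eq s ?s"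
    by (auto simp: host_eq_def)
  ultimately show ?case
    using exec.Rand[of w "r + 16" s] by fastforce
next
  case (Seq c1 a t1 a1 c2 t2 a2)
  then obtain t1' s1 where 1: "exec w (embed_com c1) s t1' s1" "t1' \<le> 5 * t1" "emb a1 s1" "host_eq s s1"
    by blast
  with Seq obtain t2' s2 where 2: "exec w (embed_com c2) s1 t2' s2" "t2' \<le> 5 * t2" "emb a2 s2" "host_eq s1 s2"
    by blast
  have "t1' + t2' \<le> 5 * (t1 + t2)" using 1 2 by simp
  with exec.Seq[OF 1(1) 2(1)] 1 2 host_eq_trans show ?case by fastforce
next
  case (IfTrue e a c1 t a' c2)
  then obtain t1 s1 where 1: "exec w (embed_com c1) s t1 s1" "t1 \<le> 5 * t" "emb a' s1" "host_eq s s1"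
    by blast
  have "val w (embed_exp e) s \<noteq> 0" using IfTrue by (simp add: val_embed)
  from exec.IfTrue[OF this 1(1), of "embed_com c2"] 1 show ?case
    by (intro exI[of _ "cost e + 1 + t1"] exI[of _ s1]) auto
next
  case (IfFalse e a c2 t a' c1)
  then obtain t1 s1 where 1: "exec w (embed_com c2) s t1 s1" "t1 \<le> 5 * t" "emb a' s1" "host_eq s s1"
    by blast
  have "val w (embed_exp e) s = 0" using IfFalse by (simp add: val_embed)
  from exec.IfFalse[OF this 1(1), of "embed_com c1"] 1 show ?case
    by (intro exI[of _ "cost e + 1 + t1"] exI[of _ s1]) auto
next
  case (WhileFalse e a c)
  have "val w (embed_exp e) s = 0" using WhileFalse by (simp add: val_embed)
  from exec.WhileFalse[OF this, of "embed_com c"] WhileFalse show ?case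
    by (intro exI[of _ "cost e + 1"] exI[of _ s]) (auto simp: host_eq_refl)
next
  case (WhileTrue e a c t1 a1 t2 a2)
  then obtain t1' s1 where 1: "exec w (embed_com c) s t1' s1" "t1' \<le> 5 * t1" "emb a1 s1" "host_eq s s1"
    by blast
  with WhileTrue obtain t2' s2 where 2: "exec w (embed_com (While e c)) s1 t2' s2" "t2' \<le> 5 * t2"
    "emb a2 s2" "host_eq s1 s2"
    by blast
  have "val w (embed_exp e) s \<noteq> 0" using WhileTrue by (simp add: val_embed)
  from exec.WhileTrue[OF this 1(1) 2(1)[simplified]] 1 2 host_eq_trans show ?case
    by (intro exI[of _ "cost e + 1 + t1' + t2'"] exI[of _ s2]) auto
qed

section \<open>The complement of a neighbourhood\<close>

definition neighbours :: "nat set set \<Rightarrow> nat \<Rightarrow> nat set" where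
  "neighbours E v = {u. u \<noteq> v \<and> {v, u} \<in> E}"

definition co_graph :: "nat \<Rightarrow> nat set set \<Rightarrow> nat set set" where
  "co_graph v E = {{a, b} | a b. a \<in> neighbours E v \<and> b \<in> neighbours E v \<and> a \<noteq> b \<and> {a, b} \<notin> E}"

lemma in_co_graph:
  "{a, b} \<in> co_graph v E \<longleftrightarrow>
     a \<in> neighbours E v \<and> b \<in> neighbours E v \<and> a \<noteq> b \<and> {a, b} \<notin> E"
  unfolding co_graph_def by (auto simp: doubleton_eq_iff insert_commute)

text \<open>The vertex \<open>v\<close> is isolated in \<open>co_graph v E\<close>, so it belongs to every maximal independent set.\<close>

lemma maximal_indep_co_graph_imp_maximal_clique:
  assumes I: "maximal_indep n (co_graph v E) I" and v: "v < n \<or> n = 0"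
  shows "maximal_clique n E (I \<inter> insert v (neighbours E v))"
proof (cases "n = 0")
  case True
  with I show ?thesis by (auto simp: maximal_indep_def maximal_clique_def clique_def)
next
  case False
  with v have v: "v < n" by simp
  have sub: "I \<subseteq> {..<n}" and ind: "indep I (co_graph v E)"
    and max: "\<And>x. x < n \<Longrightarrow> x \<notin> I \<Longrightarrow> \<not> indep (I \<union> {x}) (co_graph v E)"
    using I by (auto simp: maximal_indep_def)
  have new: "\<exists>y\<in>I. {x, y} \<in> co_graph v E" if "x < n" "x \<notin> I" for x
    using max[OF that] ind unfolding indep_def by (auto simp: insert_commute)
  have vI: "v \<in> I"
    using new[OF v] by (auto simp: in_co_graph neighbours_def)
  let ?K = "I \<inter> insert v (neighbours E v)"
  have "clique ?K E"
    unfolding clique_def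
  proof (intro ballI impI)
    fix a b assume ab: "a \<in> ?K" "b \<in> ?K" "a \<noteq> b"
    then have "{a, b} \<notin> co_graph v E" using ind by (auto simp: indep_def)
    with ab show "{a, b} \<in> E" by (auto simp: in_co_graph) (auto simp: neighbours_def insert_commute)
  qed
  moreover have "\<not> clique K' E" if K': "?K \<subset> K'" "K' \<subseteq> {..<n}" for K'
  proof
    assume cl: "clique K' E"
    \<comment> \<open>A larger clique contains \<open>v\<close>, so its new vertex \<open>x\<close>
      is a neighbour of \<open>v\<close> outside \<open>I\<close>. Maximality gives an H-neighbour
      \<open>y\<close> of \<open>x\<close> in \<open>I\<close>; being a neighbour of
      \<open>v\<close>, it lies in \<open>K'\<close>, yet \<open>x\<close> and \<open>y\<close> are
      not adjacent in \<open>E\<close>.\<close>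
    from K' obtain x where x: "x \<in> K'" "x \<notin> ?K" by blast
    have "v \<in> K'" using vI K' by blast
    with x vI cl have xN: "x \<in> neighbours E v" by (auto simp: clique_def neighbours_def)
    with x have "x \<notin> I" by blast
    with new x K' obtain y where y: "y \<in> I" "{x, y} \<in> co_graph v E" by blast
    then have "y \<in> K'" using K' by (auto simp: in_co_graph)
    with y x cl show False by (auto simp: in_co_graph clique_def)
  qed
  ultimately show ?thesis
    using sub by (auto simp: maximal_clique_def)
qed

section \<open>Update sequences between complement graphs\<close>

fun legal_updates :: "nat \<Rightarrow> nat set set \<Rightarrow> update list \<Rightarrow> bool" where
  "legal_updates n E [] \<longleftrightarrow> True"
| "legal_updates n E (x # xs) \<longleftrightarrow> legal_update n E x \<and> legal_updates n (apply_update x E) xs"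

definition apply_updates :: "update list \<Rightarrow> nat set set \<Rightarrow> nat set set" where
  "apply_updates xs E = fold apply_update xs E"

lemma apply_updates_simps [simp]:
  "apply_updates [] E = E" "apply_updates (x # xs) E = apply_updates xs (apply_update x E)"
  "apply_updates (xs @ ys) E = apply_updates ys (apply_updates xs E)"
  by (simp_all add: apply_updates_def)

lemma legal_updates_append:
  "legal_updates n E (xs @ ys) \<longleftrightarrow> legal_updates n E xs \<and> legal_updates n (apply_updates xs E) ys"
  by (induction xs arbitrary: E) auto

lemma legal_updates_nth:
  "legal_updates n E xs \<Longrightarrow> j < length xs \<Longrightarrow> legal_update n (apply_updates (take j xs) E) (xs ! j)"
  by (induction xs arbitrary: E j) (auto simp: nth_Cons' take_Cons')

text \<open>The list \<open>nbs\<close> enumerates the neighbours of \<open>v\<close> in the initial graph.\<close>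

definition co_pairs :: "nat set \<Rightarrow> nat set set \<Rightarrow> nat \<Rightarrow> nat list \<Rightarrow> nat list" where
  "co_pairs M E u xs = filter (\<lambda>x. x \<in> M \<and> x \<noteq> u \<and> {u, x} \<notin> E) xs"

text \<open>Each neighbour is joined only to earlier entries of \<open>nbs\<close>, so every
  non-adjacent pair is inserted exactly once.\<close>

definition initial_updates :: "nat \<Rightarrow> nat set set \<Rightarrow> nat list \<Rightarrow> nat \<Rightarrow> update list" where
  "initial_updates v E nbs i =
     concat (map (\<lambda>i. map (Insert (nbs ! i)) (co_pairs (insert v (neighbours E v)) E (nbs ! i) (take i nbs))) [0..<i])"

text \<open>The mixed use of old neighbourhood and new edge set follows the host: it clears the
  matrix entries of the deleted edge first, and the cell of array 4 only after the scan.\<close>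

fun co_updates :: "nat \<Rightarrow> nat list \<Rightarrow> nat set set \<Rightarrow> update \<Rightarrow> update list" where
  "co_updates v nbs E (Delete a b) =
     (if a = v then map (Delete b) (co_pairs (insert v (neighbours E v)) (E - {{a, b}}) b nbs)
      else if b = v then map (Delete a) (co_pairs (insert v (neighbours E v)) (E - {{a, b}}) a nbs)
      else if a \<in> neighbours E v \<and> b \<in> neighbours E v then [Insert a b] else [])"
| "co_updates v nbs E (Insert a b) = []"

lemma legal_insert_star:
  assumes "distinct xs" "u < n" "\<And>x. x \<in> set xs \<Longrightarrow> x < n \<and> x \<noteq> u \<and> {u, x} \<notin> F"
  shows "legal_updates n F (map (Insert u) xs) \<and>
    apply_updates (map (Insert u) xs) F = F \<union> (\<lambda>x. {u, x}) ` set xs"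
  using assms
proof (induction xs arbitrary: F)
  case (Cons x xs)
  have "legal_updates n (F \<union> {{u, x}}) (map (Insert u) xs) \<and>
    apply_updates (map (Insert u) xs) (F \<union> {{u, x}}) = (F \<union> {{u, x}}) \<union> (\<lambda>x. {u, x}) ` set xs"
    using Cons.prems by (intro Cons.IH) (auto simp: doubleton_eq_iff)
  with Cons.prems show ?case by auto
qed simp

lemma legal_delete_star:
  assumes "distinct xs" "\<And>x. x \<in> set xs \<Longrightarrow> {u, x} \<in> F"
  shows "legal_updates n F (map (Delete u) xs) \<and>
    apply_updates (map (Delete u) xs) F = F - (\<lambda>x. {u, x}) ` set xs"
  using assms
proof (induction xs arbitrary: F)
  case (Cons x xs)
  have "legal_updates n (F - {{u, x}}) (map (Delete u) xs) \<and>
    apply_updates (map (Delete u) xs) (F - {{u, x}}) = (F - {{u, x}}) - (\<lambda>x. {u, x}) ` set xs"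
    using Cons.prems by (intro Cons.IH) (auto simp: doubleton_eq_iff)
  with Cons.prems show ?case by auto
qed simp

lemma initial_updates_Suc:
  "initial_updates v E nbs (Suc i) = initial_updates v E nbs i @
     map (Insert (nbs ! i)) (co_pairs (insert v (neighbours E v)) E (nbs ! i) (take i nbs))"
  by (simp add: initial_updates_def)

lemma length_co_pairs: "length (co_pairs M E u xs) \<le> length xs"
  by (simp add: co_pairs_def)

lemma length_initial_updates: "i \<le> length nbs \<Longrightarrow> length (initial_updates v E nbs i) \<le> i * i"
proof (induction i)
  case (Suc i)
  then show ?case
    using length_co_pairs[of "insert v (neighbours E v)" E "nbs ! i" "take i nbs"]
    by (simp add: initial_updates_Suc)
qed (simp add: initial_updates_def)

lemma initial_updates:
  assumes nbs: "distinct nbs" "set nbs = neighbours E v" "\<And>u. u \<in> set nbs \<Longrightarrow> u < n"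
  shows "legal_updates n {} (initial_updates v E nbs (length nbs))" (is ?legal)
    and "apply_updates (initial_updates v E nbs (length nbs)) {} = co_graph v E" (is ?app)
proof -
  \<comment> \<open>The invariant: \<open>?P i\<close> is the complement graph restricted to the
    first \<open>i\<close> neighbours.\<close>
  let ?P = "\<lambda>i. {{a, b} | a b. a \<in> set (take i nbs) \<and> b \<in> set (take i nbs) \<and> a \<noteq> b \<and> {a, b} \<notin> E}"
  have "legal_updates n {} (initial_updates v E nbs i) \<and> apply_updates (initial_updates v E nbs i) {} = ?P i"
    if "i \<le> length nbs" for i
    using that
  proof (induction i)
    case 0
    then show ?case by (auto simp: initial_updates_def)
  next
    case (Suc i)
    let ?u = "nbs ! i"
    let ?xs = "co_pairs (insert v (neighbours E v)) E ?u (take i nbs)"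
    have i: "i < length nbs" using Suc by simp
    then have new: "?u \<notin> set (take i nbs)"
      using nbs(1) by (metis distinct_take id_take_nth_drop not_distinct_conv_prefix take_Suc_conv_app_nth
          distinct.simps(2) distinct_append disjoint_insert(1) list.simps(15))
    have sub: "set (take i nbs) \<subseteq> set nbs" by (rule set_take_subset)
    have xs: "set ?xs = {x \<in> set (take i nbs). {?u, x} \<notin> E}"
      using sub nbs(2) new by (auto simp: co_pairs_def)
    have star: "legal_updates n (?P i) (map (Insert ?u) ?xs) \<and>
        apply_updates (map (Insert ?u) ?xs) (?P i) = ?P i \<union> (\<lambda>x. {?u, x}) ` set ?xs"
    proof (rule legal_insert_star)
      show "distinct ?xs" using nbs(1) by (simp add: co_pairs_def)
      show "?u < n" using nbs(3) i by simp
      show "x < n \<and> x \<noteq> ?u \<and> {?u, x} \<notin> ?P i" if "x \<in> set ?xs" for x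
        using that nbs(3) sub new unfolding xs by (auto simp: doubleton_eq_iff)
    qed
    have "?P i \<union> (\<lambda>x. {?u, x}) ` set ?xs = ?P (Suc i)"
      unfolding xs take_Suc_conv_app_nth[OF i] using new
      by (auto simp: insert_commute)
    with star Suc show ?case
      by (simp add: initial_updates_Suc legal_updates_append)
  qed
  from this[of "length nbs"] show ?legal ?app
    using nbs(2) by (auto simp: co_graph_def)
qed

lemma neighbours_delete:
  "neighbours (E - {{a, b}}) v =
     (if a = v then neighbours E v - {b} else if b = v then neighbours E v - {a} else neighbours E v)"
  by (auto simp: neighbours_def doubleton_eq_iff)

lemma co_updates:
  assumes E: "\<And>x y. {x, y} \<in> E \<Longrightarrow> x < n \<and> y < n \<and> x \<noteq> y"
    and ab: "{a, b} \<in> E" and nbs: "distinct nbs" "neighbours E v \<subseteq> set nbs" "v \<notin> set nbs"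
  shows "legal_updates n (co_graph v E) (co_updates v nbs E (Delete a b))" (is ?legal)
    and "apply_updates (co_updates v nbs E (Delete a b)) (co_graph v E) = co_graph v (E - {{a, b}})"
      (is ?app)
proof -
  have ne: "a \<noteq> b" "a < n" "b < n" using E[OF ab] by auto
  have star: "legal_updates n (co_graph v E) (map (Delete u) xs) \<and>
      apply_updates (map (Delete u) xs) (co_graph v E) = co_graph v (E - {{v, u}})"
    if u: "{v, u} \<in> E" and xs: "xs = co_pairs (insert v (neighbours E v)) (E - {{v, u}}) u nbs"
    for u xs
  proof -
    have "u \<noteq> v" using E[OF u] by auto
    then have uN: "u \<in> neighbours E v" using u by (simp add: neighbours_def)
    have sxs: "set xs = {x \<in> neighbours E v. x \<noteq> u \<and> {u, x} \<notin> E}"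
      unfolding xs co_pairs_def using nbs by (auto simp: doubleton_eq_iff neighbours_def)
    have "legal_updates n (co_graph v E) (map (Delete u) xs) \<and>
      apply_updates (map (Delete u) xs) (co_graph v E) = co_graph v E - (\<lambda>x. {u, x}) ` set xs"
    proof (rule legal_delete_star)
      show "distinct xs" using nbs by (simp add: xs co_pairs_def)
      show "{u, x} \<in> co_graph v E" if "x \<in> set xs" for x
        using that uN by (auto simp: sxs in_co_graph)
    qed
    moreover have "co_graph v E - (\<lambda>x. {u, x}) ` set xs = co_graph v (E - {{v, u}})"
    proof (rule set_eqI)
      fix e
      show "e \<in> co_graph v E - (\<lambda>x. {u, x}) ` set xs \<longleftrightarrow> e \<in> co_graph v (E - {{v, u}})"
      proof (cases "\<exists>x y. e = {x, y}")
        case True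
        then obtain x y where e: "e = {x, y}" by blast
        have "e \<in> (\<lambda>x. {u, x}) ` set xs \<longleftrightarrow> (x = u \<and> y \<in> set xs) \<or> (y = u \<and> x \<in> set xs)"
          unfolding e by (auto simp: doubleton_eq_iff)
        moreover have "neighbours (E - {{v, u}}) v = neighbours E v - {u}"
          by (simp add: neighbours_delete)
        \<comment> \<open>The deleted edge contains \<open>v\<close>, which is not its own
          neighbour. So no pair inside the neighbourhood changes its adjacency, and only the pairs
          at \<open>u\<close> disappear.\<close>
        moreover have "x \<in> neighbours E v \<Longrightarrow> y \<in> neighbours E v \<Longrightarrow> {x, y} \<noteq> {v, u}"
          by (auto simp: neighbours_def doubleton_eq_iff)
        ultimately show ?thesis
          using uN unfolding e sxs by (auto simp: in_co_graph insert_commute)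
      qed (auto simp: co_graph_def)
    qed
    ultimately show ?thesis by simp
  qed
  consider "a = v" | "b = v" "a \<noteq> v" | "a \<noteq> v" "b \<noteq> v" by blast
  then have "?legal \<and> ?app"
  proof cases
    case 1
    with star[of b, OF _ refl] ab show ?thesis by simp
  next
    case 2
    with star[of a, OF _ refl] ab show ?thesis by (simp add: insert_commute)
  next
    case 3
    then have N: "neighbours (E - {{a, b}}) v = neighbours E v" by (simp add: neighbours_delete)
    show ?thesis
    proof (cases "a \<in> neighbours E v \<and> b \<in> neighbours E v")
      case True
      have "co_graph v (E - {{a, b}}) = co_graph v E \<union> {{a, b}}"
        unfolding co_graph_def N using True ne by (auto simp: doubleton_eq_iff)
      with True 3 ne ab show ?thesis by (auto simp: in_co_graph)
    next
      case False
      have "co_graph v (E - {{a, b}}) = co_graph v E"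
        unfolding co_graph_def N using False by (auto simp: doubleton_eq_iff)
      with False 3 show ?thesis by auto
    qed
  qed
  then show ?legal ?app by auto
qed

text \<open>Amortisation with potential \<open>D * card (neighbours E v)\<close>: a deletion at
  \<open>v\<close> issues at most \<open>D\<close> updates but lowers the potential by
  \<open>D\<close>, and any other deletion issues at most one. The total is bounded later by summing
  over the rounds.\<close>

lemma length_co_updates:
  assumes E: "\<And>x y. {x, y} \<in> E \<Longrightarrow> x \<noteq> y" and ab: "{a, b} \<in> E" and fin: "finite (neighbours E v)"
    and D: "length nbs \<le> D"
  shows "length (co_updates v nbs E (Delete a b)) + D * card (neighbours (E - {{a, b}}) v)
     \<le> 1 + D * card (neighbours E v)"
proof -
  have ne: "a \<noteq> b" using E[OF ab] .
  have star: "length (co_pairs M F u nbs) + D * card (neighbours E v - {u}) \<le> 1 + D * card (neighbours E v)"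
    if "u \<in> neighbours E v" for u M F
  proof -
    have "card (neighbours E v) = Suc (card (neighbours E v - {u}))"
      using that fin by (metis card_Suc_Diff1)
    then show ?thesis using length_co_pairs[of M F u nbs] D by simp
  qed
  consider "a = v" | "b = v" "a \<noteq> v" | "a \<noteq> v" "b \<noteq> v" by blast
  then show ?thesis
  proof cases
    case 1
    then have "b \<in> neighbours E v" using ab ne by (auto simp: neighbours_def)
    from star[OF this] 1 show ?thesis by (simp add: neighbours_delete)
  next
    case 2
    then have "a \<in> neighbours E v" using ab ne by (auto simp: neighbours_def insert_commute)
    from star[OF this] 2 show ?thesis by (simp add: neighbours_delete)
  qed (simp add: neighbours_delete)
qed

section \<open>A vertex of small degree\<close>

text \<open>The order is that of the input list, in which the host fills array 5; it fixes the order
  of the guest's updates.\<close>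

definition nbr_list :: "(nat \<times> nat) list \<Rightarrow> nat \<Rightarrow> nat list" where
  "nbr_list es v = map (\<lambda>(a, b). if a = v then b else a) (filter (\<lambda>(a, b). a = v \<or> b = v) es)"

lemma nbr_list_simps [simp]:
  "nbr_list [] v = []"
  "nbr_list (es @ es') v = nbr_list es v @ nbr_list es' v"
  "nbr_list (e # es) v =
     (if fst e = v then [snd e] else if snd e = v then [fst e] else []) @ nbr_list es v"
  by (auto simp: nbr_list_def split_beta)

lemma edge_list_Cons:
  "edge_list n ((a, b) # es) \<longleftrightarrow> a < n \<and> b < n \<and> a \<noteq> b \<and> {a, b} \<notin> edges es \<and> edge_list n es"
  by (auto simp: edge_list_def edges_def)

lemma edges_Cons: "edges ((a, b) # es) = insert {a, b} (edges es)"
  by (simp add: edges_def)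

lemma edges_Nil [simp]: "edges [] = {}"
  by (simp add: edges_def)

lemma edge_listD:
  assumes "edge_list n es" "{x, y} \<in> edges es"
  shows "x < n" "y < n" "x \<noteq> y"
  using assms by (auto simp: edge_list_def edges_def doubleton_eq_iff)

lemma card_edges: "edge_list n es \<Longrightarrow> card (edges es) = length es"
  using distinct_card[of "map (\<lambda>(u, v). {u, v}) es"] by (auto simp: edge_list_def edges_def)

lemma nbr_list:
  assumes "edge_list n es"
  shows "set (nbr_list es v) = neighbours (edges es) v" "distinct (nbr_list es v)"
    "u \<in> set (nbr_list es v) \<Longrightarrow> u < n"
proof -
  have "set (nbr_list es v) = neighbours (edges es) v \<and> distinct (nbr_list es v)"
    using assms
  proof (induction es)
    case (Cons e es)
    obtain a b where e: "e = (a, b)" by (cases e)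
    have es: "a \<noteq> b" "{a, b} \<notin> edges es" "edge_list n es" using Cons e by (auto simp: edge_list_Cons)
    have "neighbours (edges (e # es)) v =
        (if a = v then {b} else if b = v then {a} else {}) \<union> neighbours (edges es) v"
      unfolding e edges_Cons using es by (auto simp: neighbours_def doubleton_eq_iff)
    moreover have "b \<notin> neighbours (edges es) a" "a \<notin> neighbours (edges es) b"
      using es by (auto simp: neighbours_def insert_commute)
    ultimately show ?case using Cons.IH[OF es(3)] e by auto
  qed (simp add: neighbours_def)
  then show *: "set (nbr_list es v) = neighbours (edges es) v" "distinct (nbr_list es v)" by auto
  show "u \<in> set (nbr_list es v) \<Longrightarrow> u < n"
    using edge_listD[OF assms] unfolding * by (auto simp: neighbours_def)
qed

text \<open>Each edge is counted once at each of its endpoints below \<open>N\<close>. The range is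
  arbitrary because it is used twice: with all vertices for the existence of a pivot, and with the
  vertices before the pivot to bound its index.\<close>

lemma sum_degrees_le:
  assumes "edge_list n es"
  shows "(\<Sum>i<N. length (nbr_list es i)) \<le> 2 * length es"
  using assms
proof (induction es)
  case (Cons e es)
  obtain a b where e: "e = (a, b)" by (cases e)
  have "(\<Sum>i<N. length (nbr_list (e # es) i)) =
      (\<Sum>i<N. if i = a \<or> i = b then 1 else 0) + (\<Sum>i<N. length (nbr_list es i))"
    unfolding sum.distrib[symmetric] e by (intro sum.cong) auto
  also have "(\<Sum>i<N. if i = a \<or> i = b then 1 else 0) \<le> (2::nat)"
  proof -
    have "(\<Sum>i<N. if i = a \<or> i = b then 1 else 0) = card ({..<N} \<inter> {i. i = a \<or> i = b})"
      by (simp add: sum.If_cases)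
    also have "\<dots> \<le> card {a, b}" by (intro card_mono) auto
    also have "\<dots> \<le> 2" by (simp add: card_insert_if)
    finally show ?thesis .
  qed
  finally show ?case using Cons e by (simp add: edge_list_Cons)
qed simp

text \<open>The least choice is the one that a linear search finds.\<close>

definition pivot :: "(nat \<times> nat) list \<Rightarrow> nat" where
  "pivot es = (LEAST v. length (nbr_list es v) * (length (nbr_list es v) + 1) \<le> 2 * length es)"

text \<open>A vertex of minimum degree satisfies the condition, since its degree is less than
  \<open>n\<close> and \<open>n\<close> times it is at most the degree sum. The index bound is
  independent of \<open>n\<close>: a vertex of degree 0 would pass the test, so all vertices skipped
  by the search have positive degree.\<close>

lemma pivot:
  assumes es: "edge_list n es"
  shows "length (nbr_list es (pivot es)) * (length (nbr_list es (pivot es)) + 1) \<le> 2 * length es"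
      (is "?P (pivot es)")
    and "pivot es < n \<or> n = 0" and "pivot es \<le> 2 * length es"
    and "i < pivot es \<Longrightarrow> 2 * length es < length (nbr_list es i) * (length (nbr_list es i) + 1)"
proof -
  let ?d = "\<lambda>v. length (nbr_list es v)"
  have "\<exists>v. ?P v \<and> (v < n \<or> n = 0)"
  proof (cases "n = 0")
    case True
    then have "es = []" using es by (cases es) (auto simp: edge_list_Cons)
    then show ?thesis using True by auto
  next
    case False
    define v where "v = arg_min_on ?d {..<n}"
    have v: "v < n" "\<And>i. i < n \<Longrightarrow> ?d v \<le> ?d i"
      using arg_min_if_finite[of "{..<n}" ?d] False arg_min_least[of "{..<n}" _ ?d]
      unfolding v_def by auto
    have "set (nbr_list es v) \<subseteq> {..<n} - {v}"
      using nbr_list(3)[OF es] nbr_list(1)[OF es] by (auto simp: neighbours_def)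
    from card_mono[OF _ this] have "?d v < n"
      using v distinct_card[OF nbr_list(2)[OF es]] by simp
    then have "(?d v + 1) * ?d v \<le> n * ?d v" by (intro mult_le_mono) auto
    then have "?d v * (?d v + 1) \<le> (\<Sum>i<n. ?d v)" by (simp add: mult.commute)
    also have "\<dots> \<le> (\<Sum>i<n. ?d i)" using v(2) by (intro sum_mono) auto
    also have "\<dots> \<le> 2 * length es" by (rule sum_degrees_le[OF es])
    finally show ?thesis using v by blast
  qed
  then obtain v where v: "?P v" "v < n \<or> n = 0" by blast
  show "?P (pivot es)" unfolding pivot_def by (rule LeastI[of ?P, OF v(1)])
  have "pivot es \<le> v" unfolding pivot_def by (rule Least_le[of ?P, OF v(1)])
  with v show "pivot es < n \<or> n = 0" by auto
  show less: "2 * length es < ?d i * (?d i + 1)" if "i < pivot es" for i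
    using not_less_Least[of i ?P] that unfolding pivot_def by auto
  have "(\<Sum>i<pivot es. 1) \<le> (\<Sum>i<pivot es. ?d i)"
  proof (rule sum_mono)
    fix i assume "i \<in> {..<pivot es}"
    with less[of i] have "?d i \<noteq> 0" by (intro notI) simp
    then show "1 \<le> ?d i" by linarith
  qed
  with sum_degrees_le[OF es, of "pivot es"] show "pivot es \<le> 2 * length es" by simp
qed

section \<open>The simulated adversary\<close>

text \<open>\<open>play \<sigma> E v nbs ms i\<close>: if \<open>ms\<close> are the independent sets output by the guest, the cliques
  shown to \<open>\<sigma>\<close> before round \<open>i\<close> ends, and all guest updates up to that moment.\<close>

fun play :: "adversary \<Rightarrow> nat set set \<Rightarrow> nat \<Rightarrow> nat list \<Rightarrow> nat set list \<Rightarrow> nat \<Rightarrow>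
    nat set list \<times> update list" where
  "play \<sigma> E v nbs ms 0 = ([], initial_updates v E nbs (length nbs))"
| "play \<sigma> E v nbs ms (Suc i) =
     (let (cs, us) = play \<sigma> E v nbs ms i; E' = graph_at \<sigma> E cs i;
          cs' = cs @ [ms ! length us \<inter> insert v (neighbours E' v)]
      in (cs', us @ co_updates v nbs E' (\<sigma> cs')))"

text \<open>The guest's time bound is for a prescribed number of updates, so the remaining ones toggle
  the edge between 0 and 1.\<close>

fun toggles :: "nat \<Rightarrow> nat set set \<Rightarrow> update list" where
  "toggles 0 F = []"
| "toggles (Suc N) F =
     (let x = (if {0, 1} \<in> F then Delete 0 1 else Insert 0 1) in x # toggles N (apply_update x F))"

definition script :: "adversary \<Rightarrow> nat set set \<Rightarrow> nat \<Rightarrow> nat list \<Rightarrow> nat \<Rightarrow> nat \<Rightarrow> nat set list \<Rightarrow>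
    update list" where
  "script \<sigma> E v nbs k N ms =
     (let us = snd (play \<sigma> E v nbs ms k) in us @ toggles (N - length us) (apply_updates us {}))"

text \<open>One output precedes the first update, so after \<open>length ms\<close> outputs the
  update with index \<open>length ms - 1\<close> is due. The script is computed from the partial
  list \<open>ms\<close>; its later entries may rest on unspecified values of \<open>!\<close>, but
  the one selected here does not, by \<open>script_cong\<close>.\<close>

definition guest_adversary ::
    "adversary \<Rightarrow> nat set set \<Rightarrow> nat \<Rightarrow> nat list \<Rightarrow> nat \<Rightarrow> nat \<Rightarrow> adversary" where
  "guest_adversary \<sigma> E v nbs k N ms = script \<sigma> E v nbs k N ms ! (length ms - 1)"

lemma length_toggles [simp]: "length (toggles N F) = N"
  by (induction N arbitrary: F) (auto simp: Let_def)

lemma legal_toggles: "2 \<le> n \<or> N = 0 \<Longrightarrow> legal_updates n F (toggles N F)"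
  by (induction N arbitrary: F) (auto simp: Let_def)

text \<open>Causality of the replay. A round reads \<open>ms\<close> at position
  \<open>length us\<close>. If this is at most \<open>j\<close>, both replays read the same set and
  stay equal; otherwise the first \<open>j + 1\<close> updates are already fixed. The second
  conjunct carries the induction through the first case.\<close>

lemma play_cong:
  assumes "\<And>l. l \<le> j \<Longrightarrow> ms1 ! l = ms2 ! l"
  shows "take (Suc j) (snd (play \<sigma> E v nbs ms1 i)) = take (Suc j) (snd (play \<sigma> E v nbs ms2 i)) \<and>
    (length (snd (play \<sigma> E v nbs ms1 i)) \<le> j \<longrightarrow> play \<sigma> E v nbs ms1 i = play \<sigma> E v nbs ms2 i)"
proof (induction i)
  case (Suc i)
  obtain cs1 us1 where 1: "play \<sigma> E v nbs ms1 i = (cs1, us1)" by (cases "play \<sigma> E v nbs ms1 i")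
  obtain cs2 us2 where 2: "play \<sigma> E v nbs ms2 i = (cs2, us2)" by (cases "play \<sigma> E v nbs ms2 i")
  show ?case
  proof (cases "length us1 \<le> j")
    case True
    with Suc assms 1 2 show ?thesis by (simp add: Let_def)
  next
    case False
    from Suc 1 2 have eq: "take (Suc j) us1 = take (Suc j) us2" by simp
    then have "min (Suc j) (length us1) = min (Suc j) (length us2)" by (metis length_take min.commute)
    with False have "Suc j \<le> length us1" "Suc j \<le> length us2" by auto
    with eq 1 2 show ?thesis by (simp add: Let_def)
  qed
qed simp

lemma script_cong:
  assumes ms: "\<And>l. l \<le> j \<Longrightarrow> ms1 ! l = ms2 ! l"
  shows "take (Suc j) (script \<sigma> E v nbs k N ms1) = take (Suc j) (script \<sigma> E v nbs k N ms2)"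
proof -
  let ?us1 = "snd (play \<sigma> E v nbs ms1 k)" and ?us2 = "snd (play \<sigma> E v nbs ms2 k)"
  have eq: "take (Suc j) ?us1 = take (Suc j) ?us2"
    and eq': "length ?us1 \<le> j \<Longrightarrow> ?us1 = ?us2"
    using play_cong[OF ms, of j \<sigma> E v nbs k] by auto
  show ?thesis
  proof (cases "length ?us1 \<le> j")
    case True
    with eq' show ?thesis by (simp add: script_def)
  next
    case False
    from eq have "min (Suc j) (length ?us1) = min (Suc j) (length ?us2)" by (metis length_take min.commute)
    with False have "Suc j \<le> length ?us1" "Suc j \<le> length ?us2" by auto
    with eq show ?thesis by (simp add: script_def Let_def)
  qed
qed

text \<open>The cliques shown to \<open>\<sigma>\<close> may differ, but it sees only how many there
  are. The graphs must be carried along because \<open>co_updates\<close> depends on them.\<close>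

lemma play_oblivious:
  assumes "of_kind Oblivious \<sigma>"
  shows "length (fst (play \<sigma> E v nbs ms1 i)) = i \<and> length (fst (play \<sigma> E v nbs ms2 i)) = i \<and>
    snd (play \<sigma> E v nbs ms1 i) = snd (play \<sigma> E v nbs ms2 i) \<and>
    graph_at \<sigma> E (fst (play \<sigma> E v nbs ms1 i)) i = graph_at \<sigma> E (fst (play \<sigma> E v nbs ms2 i)) i"
proof -
  have \<sigma>: "\<sigma> os = \<sigma> os'" if "length os = length os'" for os os'
    using assms that unfolding of_kind.simps by blast
  have graph: "graph_at \<sigma> E os i = graph_at \<sigma> E os' i" if "length os = length os'" for os os' i
    using that
  proof (induction i)
    case (Suc i)
    then show ?case using \<sigma>[of "take (Suc i) os" "take (Suc i) os'"] by simp
  qed simp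
  show ?thesis
  proof (induction i)
    case (Suc i)
    obtain cs1 us1 where 1: "play \<sigma> E v nbs ms1 i = (cs1, us1)" by (cases "play \<sigma> E v nbs ms1 i")
    obtain cs2 us2 where 2: "play \<sigma> E v nbs ms2 i = (cs2, us2)" by (cases "play \<sigma> E v nbs ms2 i")
    from Suc 1 2 have l: "length cs1 = i" "length cs2 = i" "us1 = us2"
      "graph_at \<sigma> E cs1 i = graph_at \<sigma> E cs2 i" by auto
    have "\<sigma> (cs1 @ [X]) = \<sigma> (cs2 @ [Y])" for X Y by (rule \<sigma>) (simp add: l)
    moreover have "graph_at \<sigma> E (cs1 @ [X]) (Suc i) = graph_at \<sigma> E (cs2 @ [Y]) (Suc i)" for X Y
      by (rule graph) (simp add: l)
    ultimately show ?case using l 1 2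
      by (auto simp: Let_def simp del: graph_at.simps(2) co_updates.simps intro!: arg_cong[of _ _ "co_updates v nbs _"])
  qed simp
qed

lemma of_kind_guest_adversary:
  assumes "of_kind a \<sigma>"
  shows "of_kind a (guest_adversary \<sigma> E v nbs k N)"
proof (cases a)
  case Oblivious
  with assms have \<sigma>: "of_kind Oblivious \<sigma>" by blast
  show ?thesis
    unfolding Oblivious of_kind.simps
  proof (intro allI impI)
    fix os os' :: "nat set list" assume "length os = length os'"
    then show "guest_adversary \<sigma> E v nbs k N os = guest_adversary \<sigma> E v nbs k N os'"
      using play_oblivious[OF \<sigma>, of E v nbs os k os'] by (simp add: guest_adversary_def script_def)
  qed
qed simp

lemma graph_at_append: "i \<le> length os \<Longrightarrow> graph_at \<sigma> E (os @ os') i = graph_at \<sigma> E os i"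
  by (induction i) auto

lemma graph_at_take: "i \<le> j \<Longrightarrow> graph_at \<sigma> E (take j os) i = graph_at \<sigma> E os i"
  by (induction i) (auto simp: min_def)

abbreviation deletions :: "update set" where
  "deletions \<equiv> {Delete u v | u v. True}"

lemma legal_deletion:
  assumes "legal_adversary deletions n E k \<sigma>" "length os = Suc i" "i < k"
  obtains a b where "\<sigma> os = Delete a b" "{a, b} \<in> graph_at \<sigma> E os i"
proof -
  have "\<sigma> os \<in> deletions" "legal_update n (graph_at \<sigma> E os i) (\<sigma> os)"
    using assms unfolding legal_adversary_def by (metis Suc_leI diff_Suc_1 zero_less_Suc)+
  with that show ?thesis by auto
qed

lemma legal_deletions_le:
  assumes "legal_adversary deletions n E k \<sigma>" "finite E"
  shows "k \<le> card E"
proof -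
  \<comment> \<open>Legality holds whatever the outputs are, so any list of length \<open>k\<close>
    can be tried; each round then removes an edge that is present.\<close>
  define os :: "nat set list" where "os = replicate k {}"
  have "finite (graph_at \<sigma> E os i) \<and> card (graph_at \<sigma> E os i) + i = card E" if "i \<le> k" for i
    using that
  proof (induction i)
    case (Suc i)
    obtain a b where ab: "\<sigma> (take (Suc i) os) = Delete a b" "{a, b} \<in> graph_at \<sigma> E (take (Suc i) os) i"
      using legal_deletion[OF assms(1), of "take (Suc i) os" i] Suc.prems by (auto simp: os_def)
    then have "{a, b} \<in> graph_at \<sigma> E os i" by (simp add: graph_at_take)
    moreover have "finite (graph_at \<sigma> E os i)" "card (graph_at \<sigma> E os i) + i = card E"
      using Suc by auto
    ultimately show ?case
      using ab(1) card_Suc_Diff1[of "graph_at \<sigma> E os i" "{a, b}"] by simp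
  qed (simp add: assms)
  from this[of k] show ?thesis by simp
qed

section \<open>One decremental instance and the guest's update script\<close>

locale decremental =
  fixes n :: nat and es :: "(nat \<times> nat) list" and \<sigma> :: adversary and k N :: nat
  assumes es: "edge_list n es"
    and legal: "legal_adversary deletions n (edges es) k \<sigma>"
    and N: "N = 5 * length es"
begin

abbreviation "v \<equiv> pivot es"
abbreviation "nbs \<equiv> nbr_list es v"
abbreviation "d \<equiv> length nbs"
abbreviation "cliques ms i \<equiv> fst (play \<sigma> (edges es) v nbs ms i)"
abbreviation "issued ms i \<equiv> snd (play \<sigma> (edges es) v nbs ms i)"
abbreviation "host_graph ms i \<equiv> graph_at \<sigma> (edges es) (cliques ms i) i"
abbreviation "hood E \<equiv> insert v (neighbours E v)"
abbreviation "scr \<equiv> script \<sigma> (edges es) v nbs k N"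
abbreviation "\<tau> \<equiv> guest_adversary \<sigma> (edges es) v nbs k N"

lemma k_le: "k \<le> length es"
  using legal_deletions_le[OF legal] card_edges[OF es] by (simp add: edges_def)

lemma d_le: "d * (d + 1) \<le> 2 * length es"
  by (rule pivot(1)[OF es])

lemma finite_hood: "E \<subseteq> edges es \<Longrightarrow> finite (neighbours E v)"
  by (rule finite_subset[of _ "{..<n}"]) (auto simp: neighbours_def dest: edge_listD[OF es])

lemma length_cliques [simp]: "length (cliques ms i) = i"
  by (induction i) (auto simp: Let_def split_beta)

lemma cliques_Suc: "cliques ms (Suc i) = cliques ms i @ [ms ! length (issued ms i) \<inter> hood (host_graph ms i)]"
  by (simp add: Let_def split_beta)

lemma issued_Suc:
  "issued ms (Suc i) = issued ms i @ co_updates v nbs (host_graph ms i) (\<sigma> (cliques ms (Suc i)))"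
  by (simp add: Let_def split_beta)

declare play.simps(2) [simp del]

lemma host_graph_Suc: "host_graph ms (Suc i) = apply_update (\<sigma> (cliques ms (Suc i))) (host_graph ms i)"
  by (simp only: graph_at.simps cliques_Suc) (simp add: graph_at_append)

lemma next_deletion:
  assumes "i < k"
  obtains a b where "\<sigma> (cliques ms (Suc i)) = Delete a b" "{a, b} \<in> host_graph ms i"
proof (rule legal_deletion[OF legal, of "cliques ms (Suc i)" i])
  fix a b assume "\<sigma> (cliques ms (Suc i)) = Delete a b"
    "{a, b} \<in> graph_at \<sigma> (edges es) (cliques ms (Suc i)) i"
  then show thesis
    using that[of a b] by (simp only: cliques_Suc graph_at_append length_cliques order_refl)
qed (use assms in \<open>simp_all only: length_cliques\<close>)

lemma host_graph_subset: "i \<le> k \<Longrightarrow> host_graph ms i \<subseteq> edges es"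
proof (induction i)
  case (Suc i)
  then obtain a b where "\<sigma> (cliques ms (Suc i)) = Delete a b" using next_deletion[of i ms] by (metis Suc_le_lessD)
  with Suc show ?case unfolding host_graph_Suc by auto
qed simp

text \<open>The third claim sums \<open>length_co_updates\<close> over the rounds: initialization
  contributes at most \<open>d * d\<close> insertions and a potential of \<open>d * d\<close>, and
  each round raises the sum by at most 1.\<close>

lemma issued:
  assumes "i \<le> k"
  shows "legal_updates n {} (issued ms i)" (is "?legal i")
    and "apply_updates (issued ms i) {} = co_graph v (host_graph ms i)" (is "?app i")
    and "length (issued ms i) + d * card (neighbours (host_graph ms i) v) \<le> 2 * d * d + i" (is "?len i")
proof -
  note E = edge_listD[OF es]
  have nbs: "distinct nbs" "set nbs = neighbours (edges es) v" "\<And>u. u \<in> set nbs \<Longrightarrow> u < n"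
    using nbr_list[OF es] by auto
  have "?legal i \<and> ?app i \<and> ?len i" using assms
  proof (induction i)
    case 0
    have "card (neighbours (edges es) v) = d" using nbs distinct_card by metis
    with initial_updates[OF nbs] length_initial_updates[of d nbs v "edges es"] show ?case by simp
  next
    case (Suc i)
    then have i: "i < k" "i \<le> k" by auto
    obtain a b where ab: "\<sigma> (cliques ms (Suc i)) = Delete a b" "{a, b} \<in> host_graph ms i"
      using next_deletion[OF i(1)] by blast
    note sub = host_graph_subset[OF i(2), of ms]
    have nb: "neighbours (host_graph ms i) v \<subseteq> set nbs" "v \<notin> set nbs"
      using sub nbs(2) by (auto simp: neighbours_def)
    have H: "x < n \<and> y < n \<and> x \<noteq> y" if "{x, y} \<in> host_graph ms i" for x y
      using E sub that by blast
    note co = co_updates[OF H ab(2) nbs(1) nb]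
    note len = length_co_updates[OF _ ab(2) finite_hood[OF sub] order_refl, of nbs]
    have "\<And>x y. {x, y} \<in> host_graph ms i \<Longrightarrow> x \<noteq> y" using H by blast
    with len co Suc i show ?case
      unfolding issued_Suc host_graph_Suc ab(1) by (auto simp: legal_updates_append)
  qed
  then show "?legal i" "?app i" "?len i" by auto
qed

lemma length_issued: "i \<le> k \<Longrightarrow> length (issued ms i) \<le> N"
  using issued(3)[of i ms] d_le k_le N by (simp add: algebra_simps)

lemma length_scr [simp]: "length (scr ms) = N"
  using length_issued[of k ms] by (simp add: script_def Let_def)

lemma legal_scr: "legal_updates n {} (scr ms)"
proof -
  \<comment> \<open>The padding toggles the edge between 0 and 1. Any input edge forces two
    vertices, and without edges there is nothing to pad.\<close>
  have "2 \<le> n \<or> N = 0"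
    using es by (cases es) (auto simp: N edge_list_Cons)
  then show ?thesis
    using issued(1)[of k ms] by (auto simp: script_def Let_def legal_updates_append intro: legal_toggles)
qed

lemma scr_prefix: "i \<le> k \<Longrightarrow> \<exists>us. scr ms = issued ms i @ us"
proof -
  have "\<exists>us. issued ms j = issued ms i @ us" if "i \<le> j" for j
    using that
  proof (induction j rule: dec_induct)
    case (step j)
    then obtain us where "issued ms j = issued ms i @ us" by blast
    then show ?case unfolding issued_Suc by simp
  qed simp
  moreover assume "i \<le> k"
  ultimately show ?thesis unfolding script_def Let_def by fastforce
qed

text \<open>By causality the update chosen online from a prefix of the outputs is the entry of the
  script computed from all of them. This lets the rest of the proof work with one fixed
  script.\<close>

lemma \<tau>_take:
  assumes "j < length ms" "j < N"
  shows "\<tau> (take (Suc j) ms) = scr ms ! j"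
proof -
  have "take (Suc j) (scr (take (Suc j) ms)) = take (Suc j) (scr ms)"
    by (rule script_cong) simp
  then have "scr (take (Suc j) ms) ! j = scr ms ! j" by (metis lessI nth_take)
  then show ?thesis using assms by (simp add: guest_adversary_def)
qed

lemma graph_at_\<tau>:
  "j \<le> N \<Longrightarrow> j < length ms \<Longrightarrow> graph_at \<tau> {} ms j = apply_updates (take j (scr ms)) {}"
proof (induction j)
  case (Suc j)
  then show ?case
    by (simp add: \<tau>_take) (simp add: take_Suc_conv_app_nth)
qed simp

text \<open>Holds for every list \<open>ms\<close>: \<open>issued\<close> relies only on the
  legality of \<open>\<sigma>\<close>, which is itself assumed for all outputs.\<close>

lemma legal_\<tau>: "legal_adversary UNIV n {} N \<tau>"
  unfolding legal_adversary_def
proof (intro allI impI conjI)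
  fix ms :: "nat set list" assume "0 < length ms \<and> length ms \<le> N"
  then have ms: "0 < length ms" "length ms \<le> N" by auto
  define j where "j = length ms - 1"
  have j: "j < length ms" "j < N" "take (Suc j) ms = ms" using ms unfolding j_def by linarith+ simp
  have "\<tau> ms = scr ms ! j" using \<tau>_take[OF j(1,2)] j(3) by simp
  moreover have "graph_at \<tau> {} ms j = apply_updates (take j (scr ms)) {}" using j by (simp add: graph_at_\<tau>)
  ultimately show "legal_update n (graph_at \<tau> {} ms (length ms - 1)) (\<tau> ms)"
    using legal_updates_nth[OF legal_scr, of j ms] j by (simp add: j_def)
qed simp

lemma maximal_clique_output:
  assumes "i \<le> k" "length (issued ms i) < length ms"
    and "maximal_indep n (graph_at \<tau> {} ms (length (issued ms i))) (ms ! length (issued ms i))"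
  shows "maximal_clique n (host_graph ms i) (ms ! length (issued ms i) \<inter> hood (host_graph ms i))"
proof (rule maximal_indep_co_graph_imp_maximal_clique)
  obtain us where "scr ms = issued ms i @ us" using scr_prefix[OF assms(1)] by blast
  then have "graph_at \<tau> {} ms (length (issued ms i)) = co_graph v (host_graph ms i)"
    using graph_at_\<tau> length_issued[OF assms(1)] assms(2) issued(2)[OF assms(1)] by simp
  with assms(3) show "maximal_indep n (co_graph v (host_graph ms i)) (ms ! length (issued ms i))" by simp
qed (use pivot(2)[OF es] in blast)

end

section \<open>The program\<close>

text \<open>Host registers: 3 the number of vertices, 4 the pivot \<open>v\<close>, 5 its initial degree, 6 to 10
  temporaries. Host arrays: 3 degrees, 4 the closed neighbourhood of \<open>v\<close>, 5 the initial neighbours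
  of \<open>v\<close>, 6 the adjacency matrix in row-major order.\<close>

definition incr :: "nat \<Rightarrow> com" where
  "incr r = Assign r (Op Add (Reg r) (Const 1))"

definition adj_index :: "exp \<Rightarrow> exp \<Rightarrow> exp" where
  "adj_index e1 e2 = Op Add (Op Mul e1 (Reg 3)) e2"

text \<open>Registers 16 to 18 are the guest's registers 0 to 2, where it expects the kind of the
  update and the endpoints.\<close>

definition call :: "com \<Rightarrow> nat \<Rightarrow> com" where
  "call U b = Seq (Assign 16 (Const b)) (Seq (Assign 17 (Reg 8)) (Seq (Assign 18 (Reg 9)) (embed_com U)))"

text \<open>The three nested tests are the filter in \<open>co_pairs\<close>, with \<open>M\<close>
  held in array 4 and \<open>E\<close> in array 6.\<close>

definition scan_body :: "com \<Rightarrow> nat \<Rightarrow> com" where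
  "scan_body U b = Seq (Assign 9 (Read 5 (Reg 7)))
     (Seq (If (Read 4 (Reg 9))
             (If (Op Eq (Reg 8) (Reg 9)) Skip
                (If (Read 6 (adj_index (Reg 8) (Reg 9))) Skip (call U b))) Skip)
        (incr 7))"

definition scan :: "com \<Rightarrow> nat \<Rightarrow> com" where
  "scan U b = Seq (Assign 7 (Const 0)) (While (Op Less (Reg 7) (Reg 10)) (scan_body U b))"

text \<open>The scan runs over all initial neighbours, as array 5 never shrinks; array 4 tells which
  of them remain. The final store to array 0 restores the mask after the cell of array 4 is
  cleared.\<close>

definition isolate :: "com \<Rightarrow> nat \<Rightarrow> com" where
  "isolate U r = Seq (Assign 8 (Reg r)) (Seq (Assign 10 (Reg 5)) (Seq (scan U 0)
     (Seq (Store 4 (Reg 8) (Const 0)) (Store 0 (Reg 8) (Const 0)))))"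

definition host_update :: "com \<Rightarrow> com" where
  "host_update U = Seq (Store 6 (adj_index (Reg 1) (Reg 2)) (Const 0))
     (Seq (Store 6 (adj_index (Reg 2) (Reg 1)) (Const 0))
     (If (Op Eq (Reg 1) (Reg 4)) (isolate U 2)
     (If (Op Eq (Reg 2) (Reg 4)) (isolate U 1)
     (If (Read 4 (Reg 1))
        (If (Read 4 (Reg 2)) (Seq (Assign 8 (Reg 1)) (Seq (Assign 9 (Reg 2)) (call U 1))) Skip) Skip))))"

text \<open>The matrix has \<open>n * n\<close> cells but starts out zero, so filling it takes time
  O(m).\<close>

definition read_edges :: com where
  "read_edges = While (Op Less (Reg 6) (Reg 1))
     (Seq (Assign 8 (Read 1 (Reg 6))) (Seq (Assign 9 (Read 2 (Reg 6)))
     (Seq (Store 3 (Reg 8) (Op Add (Read 3 (Reg 8)) (Const 1)))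
     (Seq (Store 3 (Reg 9) (Op Add (Read 3 (Reg 9)) (Const 1)))
     (Seq (Store 6 (adj_index (Reg 8) (Reg 9)) (Const 1))
     (Seq (Store 6 (adj_index (Reg 9) (Reg 8)) (Const 1)) (incr 6)))))))"

definition find_pivot :: com where
  "find_pivot = While (Op Less (Op Add (Reg 1) (Reg 1))
       (Op Mul (Read 3 (Reg 4)) (Op Add (Read 3 (Reg 4)) (Const 1)))) (incr 4)"

definition push_nbr :: "nat \<Rightarrow> com" where
  "push_nbr a = Seq (Assign 9 (Read a (Reg 6)))
     (Seq (Store 5 (Reg 5) (Reg 9)) (Seq (Store 4 (Reg 9) (Const 1)) (incr 5)))"

definition list_nbrs :: com where
  "list_nbrs = While (Op Less (Reg 6) (Reg 1))
     (Seq (If (Op Eq (Read 1 (Reg 6)) (Reg 4)) (push_nbr 2)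
             (If (Op Eq (Read 2 (Reg 6)) (Reg 4)) (push_nbr 1) Skip)) (incr 6))"

definition insert_pairs :: "com \<Rightarrow> com" where
  "insert_pairs U = While (Op Less (Reg 6) (Reg 5))
     (Seq (Assign 8 (Read 5 (Reg 6))) (Seq (Assign 10 (Reg 6)) (Seq (scan U 1) (incr 6))))"

text \<open>The guest receives \<open>n\<close> in its register 0; its register 1 is still zero,
  which announces an empty edge list.\<close>

definition host_init :: "com \<Rightarrow> com \<Rightarrow> com" where
  "host_init I U = Seq (Assign 3 (Reg 0)) (Seq read_edges (Seq find_pivot
     (Seq (Store 4 (Reg 4) (Const 1)) (Seq (Assign 6 (Const 0)) (Seq list_nbrs
     (Seq (Assign 16 (Reg 3)) (Seq (embed_com I) (Seq (Assign 6 (Const 0)) (insert_pairs U)))))))))"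

definition host_algorithm :: "dynamic_algorithm \<Rightarrow> dynamic_algorithm" where
  "host_algorithm A =
     Dynamic_Algorithm (host_init (init_prog A) (update_prog A)) (host_update (update_prog A))"

section \<open>The host along one fixed run of the guest\<close>

definition make_update :: "nat \<Rightarrow> nat \<Rightarrow> nat \<Rightarrow> update" where
  "make_update b x y = (if b = 0 then Delete x y else Insert x y)"

lemma make_update_simps [simp]: "make_update 0 x = Delete x" "make_update (Suc 0) x = Insert x"
  by (simp_all add: make_update_def fun_eq_iff)

lemma emb_set_reg [simp]: "r < 16 \<Longrightarrow> emb a (set_reg r x s) \<longleftrightarrow> emb a s"
  by (simp add: emb_def)

lemma emb_set_cell [simp]: "0 < x \<Longrightarrow> x < 16 \<Longrightarrow> x \<noteq> 4 \<Longrightarrow> emb a (set_cell x i y s) \<longleftrightarrow> emb a s"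
  by (simp add: emb_def)

text \<open>One tape and one guest run with states \<open>S\<close>, step counts \<open>tt\<close>
  and outputs \<open>ms\<close>. The fourth power in \<open>word\<close> keeps matrix indices and
  the products in the pivot test from wrapping around.\<close>

locale guest_trace = decremental +
  fixes w :: nat and A :: dynamic_algorithm and \<omega> :: "nat stream"
    and S :: "nat \<Rightarrow> state" and tt :: "nat \<Rightarrow> nat" and ms :: "nat set list"
  assumes guest_init: "exec w (init_prog A) (initial_state n [] \<omega>) (tt 0) (S 0)"
    and guest_update: "j < N \<Longrightarrow> exec w (update_prog A) (pass_update (scr ms ! j) (S j)) (tt (Suc j)) (S (Suc j))"
    and ms: "length ms = Suc N" "j \<le> N \<Longrightarrow> ms ! j = output_set n (S j)"
    and word: "(n + length es + 2) ^ 4 \<le> 2 ^ w"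
begin

abbreviation "m \<equiv> length es"
abbreviation "U \<equiv> update_prog A"

definition TT :: "nat \<Rightarrow> nat" where "TT j = (\<Sum>l\<le>j. tt l)"

lemma TT_Suc: "TT (Suc j) = TT j + tt (Suc j)"
  by (simp add: TT_def)

lemma word2: "4 * (n + m + 2) * (n + m + 2) \<le> 2 ^ w"
proof -
  have "4 * (n + m + 2) ^ 2 \<le> (n + m + 2) ^ 2 * (n + m + 2) ^ 2"
    using power_mono[of 2 "n + m + 2" 2] by (intro mult_right_mono) auto
  also have "\<dots> \<le> 2 ^ w" using word by (simp flip: power_add)
  finally show ?thesis by (simp add: power2_eq_square algebra_simps)
qed

lemma word_lin: "4 * (n + m + 2) < 2 ^ w"
proof -
  have "4 * (n + m + 2) * 2 \<le> 4 * (n + m + 2) * (n + m + 2)" by (intro mult_left_mono) auto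
  from order_trans[OF this word2] show ?thesis by simp
qed

lemma w_pos [simp]: "0 < w"
  using word_lin by (cases w) auto

lemma one_mod [simp]: "Suc 0 mod 2 ^ w = Suc 0"
  using word_lin by simp

lemma of_bool_mod [simp]: "of_bool b mod 2 ^ w = (of_bool b :: nat)"
  by (cases b) auto

lemma index_less: "x < n \<Longrightarrow> y < n \<Longrightarrow> x * n + y < 2 ^ w"
proof -
  assume "x < n" "y < n"
  then have "x * n + y < (n + m + 2) * (n + m + 2)"
  proof -
    have "x * n + y < Suc x * n" using \<open>y < n\<close> by simp
    also have "\<dots> \<le> n * n" using \<open>x < n\<close> by (intro mult_right_mono) auto
    also have "\<dots> \<le> (n + m + 2) * (n + m + 2)" by (intro mult_mono) auto
    finally show ?thesis .
  qed
  with word2 show ?thesis by linarith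
qed

lemma index_eq: "y < n \<Longrightarrow> y' < n \<Longrightarrow> x * n + y = x' * n + y' \<longleftrightarrow> x = x' \<and> y = (y'::nat)"
proof -
  assume "y < n" "y' < n"
  then have "(x * n + y) div n = x" "(x * n + y) mod n = y" "(x' * n + y') div n = x'" "(x' * n + y') mod n = y'"
    by auto
  then show ?thesis by metis
qed

lemma val_adj:
  "regs s 3 = n \<Longrightarrow> val w e1 s < n \<Longrightarrow> val w e2 s < n \<Longrightarrow>
     val w (adj_index e1 e2) s = val w e1 s * n + val w e2 s"
  using index_less[of "val w e1 s" "val w e2 s"] by (simp add: adj_index_def)

text \<open>\<open>M\<close> and \<open>E\<close> are separate parameters because, while a deletion
  at \<open>v\<close> is processed, array 4 still holds the old neighbourhood and array 6 already
  the new graph.\<close>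

definition host :: "nat set \<Rightarrow> nat set set \<Rightarrow> state \<Rightarrow> bool" where
  "host M E s \<longleftrightarrow> regs s 3 = n \<and> regs s 4 = v \<and> regs s 5 = d \<and>
     (\<forall>x<n. arrs s 4 x \<noteq> 0 \<longleftrightarrow> x \<in> M) \<and>
     (\<forall>x<n. \<forall>y<n. arrs s 6 (x * n + y) \<noteq> 0 \<longleftrightarrow> {x, y} \<in> E) \<and>
     (\<forall>i<d. arrs s 5 i = nbs ! i)"

text \<open>The constant 11 is the slowdown 5 plus 6 steps for passing the update, charged to a
  guest call of at least one step. \<open>X\<close> collects the host's own time.\<close>

lemma wp_call:
  assumes s: "emb (S j) s" and j: "j < N" "scr ms ! j = make_update b (regs s 8) (regs s 9)" "b \<le> 1"
    and t: "t \<le> 11 * TT j + X"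
    and Q: "\<And>t' s'. emb (S (Suc j)) s' \<Longrightarrow> host_eq s s' \<Longrightarrow> t' \<le> 11 * TT (Suc j) + X \<Longrightarrow> Q t' s'"
  shows "wp w (call U b) Q t s"
proof -
  let ?s = "set_reg 18 (regs s 9) (set_reg 17 (regs s 8) (set_reg 16 b s))"
  have "emb (pass_update (scr ms ! j) (S j)) ?s"
    using s j(3) unfolding j(2) by (cases "b = 0") (auto simp: emb_def make_update_def)
  from exec_embed[OF guest_update[OF j(1)] this] obtain t' s' where
    *: "exec w (embed_com U) ?s t' s'" "t' \<le> 5 * tt (Suc j)" "emb (S (Suc j)) s'" "host_eq ?s s'"
    by blast
  have "host_eq s s'" using *(4) by (simp add: host_eq_def)
  moreover have "Suc (Suc (Suc (Suc (Suc (Suc t))))) + t' \<le> 11 * TT (Suc j) + X"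
    using t *(2) exec_pos[OF guest_update[OF j(1)]] by (simp add: TT_Suc)
  ultimately have "wp w (embed_com U) Q (Suc (Suc (Suc (Suc (Suc (Suc t)))))) ?s"
    using *(3) by (intro wpI[OF *(1)] Q)
  moreover have "b mod 2 ^ w = b" using j(3) by (cases b) auto
  ultimately show ?thesis by (simp add: call_def)
qed

lemma co_pairs_nth:
  assumes "i < b" "b \<le> length xs" "xs ! i \<in> M" "xs ! i \<noteq> u" "{u, xs ! i} \<notin> E"
  shows "length (co_pairs M E u (take i xs)) < length (co_pairs M E u (take b xs))"
    and "co_pairs M E u (take b xs) ! length (co_pairs M E u (take i xs)) = xs ! i"
proof -
  have "take b xs = take i xs @ xs ! i # drop (Suc i) (take b xs)"
    using assms id_take_nth_drop[of i "take b xs"] by simp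
  from arg_cong[OF this, of "co_pairs M E u"]
  have "co_pairs M E u (take b xs) =
      co_pairs M E u (take i xs) @ xs ! i # co_pairs M E u (drop (Suc i) (take b xs))"
    using assms(3-5) by (simp only: co_pairs_def filter_append filter.simps) simp
  then show "length (co_pairs M E u (take i xs)) < length (co_pairs M E u (take b xs))"
    "co_pairs M E u (take b xs) ! length (co_pairs M E u (take i xs)) = xs ! i"
    by simp_all
qed

lemma wp_scan:
  assumes s: "host M E s" "emb (S p) s" and b: "regs s 10 = b" "b \<le> d"
    and u: "regs s 8 = u" "u < n" and op: "op \<le> 1"
    and scr: "scr ms = pre @ map (make_update op u) (co_pairs M E u (take b nbs)) @ post" "length pre = p"
    and t: "t \<le> 11 * TT p + X"
    and Q: "\<And>t' s'. emb (S (p + length (co_pairs M E u (take b nbs)))) s' \<Longrightarrow>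
      \<forall>r<14. r \<notin> {7, 9} \<longrightarrow> regs s' r = regs s r \<Longrightarrow>
      \<forall>x. 0 < x \<and> x < 16 \<longrightarrow> arrs s' x = arrs s x \<Longrightarrow>
      t' \<le> 11 * TT (p + length (co_pairs M E u (take b nbs))) + X + 30 * b + 10 \<Longrightarrow> Q t' s'"
  shows "wp w (scan U op) Q t s"
proof -
  \<comment> \<open>After \<open>i\<close> entries of the list the guest has received
    \<open>pos i\<close> updates in total, so its state is \<open>S (pos i)\<close>.\<close>
  define pos where "pos i = p + length (co_pairs M E u (take i nbs))" for i
  define I where "I i t' s' \<longleftrightarrow> regs s' 7 = i \<and> emb (S (pos i)) s' \<and>
      (\<forall>r<14. r \<notin> {7, 9} \<longrightarrow> regs s' r = regs s r) \<and>
      (\<forall>x. 0 < x \<and> x < 16 \<longrightarrow> arrs s' x = arrs s x) \<and> t' \<le> 11 * TT (pos i) + X + 30 * i + 3"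
    for i t' s'
  have nbs: "nbs ! i < n" if "i < d" for i using nbr_list(3)[OF es, of "nbs ! i" v] that by simp
  have d_word: "d + 1 < 2 ^ w"
  proof -
    have "d * 1 \<le> d * (d + 1)" by (intro mult_left_mono) auto
    with d_le have "d \<le> 2 * m" by linarith
    then show ?thesis by (intro le_less_trans[OF _ word_lin]) simp
  qed
  have step: "wp w (scan_body U op) (I (Suc i)) (Suc (Suc (Suc (Suc t')))) s'" if i: "i < b" and I: "I i t' s'" for i t' s'
  proof -
    let ?x = "nbs ! i"
    have id: "i < d" using i b by simp
    note x = nbs[OF id]
    have s': "regs s' 7 = i" "regs s' 8 = u" "regs s' 3 = n" "arrs s' 5 i = ?x"
      "arrs s' 4 ?x \<noteq> 0 \<longleftrightarrow> ?x \<in> M" "arrs s' 6 (u * n + ?x) \<noteq> 0 \<longleftrightarrow> {u, ?x} \<in> E"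
      and emb: "emb (S (pos i)) s'" and t': "t' \<le> 11 * TT (pos i) + X + 30 * i + 3"
      using I s(1) id u x unfolding I_def host_def by auto
    have mods [simp]: "Suc i mod 2 ^ w = Suc i" "(u * n + ?x) mod 2 ^ w = u * n + ?x" "u * n mod 2 ^ w = u * n"
      using d_word id index_less[OF u(2) x] by auto
    have take: "take (Suc i) nbs = take i nbs @ [?x]" using id by (rule take_Suc_conv_app_nth)
    have incr: "wp w (incr 7) (I (Suc i)) t1 s1"
      if "regs s1 7 = i" "emb (S (pos (Suc i))) s1" "\<forall>r<14. r \<notin> {7, 9} \<longrightarrow> regs s1 r = regs s r"
        "\<forall>x. 0 < x \<and> x < 16 \<longrightarrow> arrs s1 x = arrs s x" "t1 + 4 \<le> 11 * TT (pos (Suc i)) + X + 30 * Suc i + 3"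
      for t1 s1
      using that by (simp add: incr_def I_def)
    show ?thesis
    proof (cases "?x \<in> M \<and> ?x \<noteq> u \<and> {u, ?x} \<notin> E")
      case False
      then have pos: "pos (Suc i) = pos i" unfolding pos_def take by (auto simp: co_pairs_def)
      have "wp w (incr 7) (I (Suc i)) t1 (set_reg 9 ?x s')" if "t1 \<le> t' + 22" for t1
        using I t' that by (intro incr) (auto simp: I_def pos)
      then show ?thesis
        using False s' by (auto simp: scan_body_def adj_index_def)
    next
      case True
      then have pos: "pos (Suc i) = Suc (pos i)" unfolding pos_def take by (auto simp: co_pairs_def)
      note nth = co_pairs_nth[OF i b(2), of M u E]
      have "scr ms ! pos i = make_update op u ?x"
        using nth True scr(2) unfolding scr(1) pos_def by (simp add: nth_append)
      moreover have "pos i < N"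
        using nth(1) True scr length_scr[of ms] unfolding pos_def by (auto simp: simp del: length_scr)
      ultimately have "wp w (call U op) (wp w (incr 7) (I (Suc i))) t1 (set_reg 9 ?x s')"
        if "t1 \<le> t' + 22" for t1
      proof (intro wp_call[where j = "pos i" and X = "X + 30 * i + 25"])
        fix t2 s2
        assume "emb (S (Suc (pos i))) s2" "host_eq (set_reg 9 ?x s') s2"
          "t2 \<le> 11 * TT (Suc (pos i)) + (X + 30 * i + 25)"
        then show "wp w (incr 7) (I (Suc i)) t2 s2"
          using I by (intro incr) (auto simp: I_def pos host_eq_def)
      qed (use emb s' op t' that in auto)
      then show ?thesis
        using True s' by (auto simp: scan_body_def adj_index_def)
    qed
  qed
  have "wp w (While (Op Less (Reg 7) (Reg 10)) (scan_body U op)) Q (t + 2) (set_reg 7 0 s)"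
  proof (rule wp_While[where I = I and N = b])
    show "I 0 (t + 2) (set_reg 7 0 s)"
      using s t by (simp add: I_def pos_def co_pairs_def)
  next
    fix i t' s' assume "i < b" "I i t' s'"
    with step[OF this] b show "val w (Op Less (Reg 7) (Reg 10)) s' \<noteq> 0 \<and>
        wp w (scan_body U op) (I (Suc i)) (t' + (cost (Op Less (Reg 7) (Reg 10)) + 1)) s'"
      by (simp add: I_def)
  next
    fix t' s' assume "I b t' s'"
    with b Q show "val w (Op Less (Reg 7) (Reg 10)) s' = 0 \<and> Q (t' + (cost (Op Less (Reg 7) (Reg 10)) + 1)) s'"
      by (simp add: I_def pos_def)
  qed
  then show ?thesis by (simp add: scan_def)
qed

lemma wp_isolate:
  assumes s: "host M E s" "emb (S p) s" and u: "regs s r = u" "u < n"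
    and scr: "scr ms = pre @ map (Delete u) (co_pairs M E u nbs) @ post" "length pre = p"
    and t: "t \<le> 11 * TT p + X"
    and Q: "\<And>t' s'. host (M - {u}) E s' \<Longrightarrow> emb (S (p + length (co_pairs M E u nbs))) s' \<Longrightarrow>
      t' \<le> 11 * TT (p + length (co_pairs M E u nbs)) + X + 30 * d + 30 \<Longrightarrow> Q t' s'"
  shows "wp w (isolate U r) Q t s"
proof -
  have "wp w (scan U 0) (wp w (Seq (Store 4 (Reg 8) (Const 0)) (Store 0 (Reg 8) (Const 0))) Q) t1
      (set_reg 10 d (set_reg 8 u s))" if "t1 \<le> t + 4" for t1
  proof (rule wp_scan[where M = M and E = E and p = p and b = d and u = u and pre = pre and post = post and X = "X + 4"])
    show "host M E (set_reg 10 d (set_reg 8 u s))" using s by (simp add: host_def)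
  next
    fix t2 s2
    assume s2: "emb (S (p + length (co_pairs M E u (take d nbs)))) s2"
      "\<forall>r<14. r \<notin> {7, 9} \<longrightarrow> regs s2 r = regs (set_reg 10 d (set_reg 8 u s)) r"
      "\<forall>x. 0 < x \<and> x < 16 \<longrightarrow> arrs s2 x = arrs (set_reg 10 d (set_reg 8 u s)) x"
      "t2 \<le> 11 * TT (p + length (co_pairs M E u (take d nbs))) + (X + 4) + 30 * d + 10"
    \<comment> \<open>Both cells are cleared together, so array 0 is again the guest's output masked
      by array 4.\<close>
    let ?s3 = "set_cell 0 u 0 (set_cell 4 u 0 s2)"
    have "host (M - {u}) E ?s3" using s(1) s2(2,3) by (auto simp: host_def)
    moreover have "emb (S (p + length (co_pairs M E u nbs))) ?s3"
      using s2(1) by (auto simp: emb_def)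
    ultimately show "wp w (Seq (Store 4 (Reg 8) (Const 0)) (Store 0 (Reg 8) (Const 0))) Q t2 s2"
      using s2(2,4) Q by auto
  qed (use s u scr t that in auto)
  then show ?thesis
    using u s by (simp add: isolate_def host_def)
qed

text \<open>The term with \<open>card (neighbours E v)\<close> is a potential: isolating a vertex costs \<open>O(d)\<close> steps and
  shrinks the neighbourhood.\<close>

lemma wp_host_update:
  fixes i
  defines "E \<equiv> host_graph ms i" and "E' \<equiv> host_graph ms (Suc i)"
    and "p \<equiv> length (issued ms i)" and "p' \<equiv> length (issued ms (Suc i))"
  assumes i: "i < k" and s: "host (hood E) E s" "emb (S p) s" and t: "t \<le> 11 * TT p + X"
  shows "wp w (host_update U) (\<lambda>t' s'. host (hood E') E' s' \<and> emb (S p') s' \<and>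
      t' + 100 * (d + 1) * card (neighbours E' v) \<le> 11 * TT p' + X + 100 + 100 * (d + 1) * card (neighbours E v))
    t (pass_update (\<sigma> (cliques ms (Suc i))) s)" (is "wp _ _ ?Q _ _")
proof -
  obtain a b where ab: "\<sigma> (cliques ms (Suc i)) = Delete a b" "{a, b} \<in> E"
    using next_deletion[OF i] unfolding E_def by blast
  have E': "E' = E - {{a, b}}" unfolding E'_def host_graph_Suc ab(1) by (simp add: E_def)
  have sub: "E \<subseteq> edges es" using host_graph_subset[of i ms] i by (simp add: E_def)
  have ne: "a < n" "b < n" "a \<noteq> b" using edge_listD[OF es] sub ab(2) by blast+
  obtain us where us: "scr ms = issued ms i @ co_updates v nbs E (Delete a b) @ us"
    using scr_prefix[of "Suc i" ms] i unfolding issued_Suc ab(1) E_def by auto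
  have p': "p' = p + length (co_updates v nbs E (Delete a b))"
    unfolding p'_def issued_Suc ab(1) by (simp add: p_def E_def)
  let ?old = "pass_update (Delete a b) s"
  let ?s = "set_cell 6 (b * n + a) 0 (set_cell 6 (a * n + b) 0 ?old)"
  have host: "host (hood E) E' ?s"
    using s(1) ne unfolding host_def E' by (auto simp: index_eq doubleton_eq_iff)
  have emb: "emb (S p) ?s" using s(2) by simp
  have regs: "regs ?s 1 = a" "regs ?s 2 = b" "regs ?s 3 = n" "regs ?s 4 = v" "regs ?old 3 = n"
    "\<And>x. x < n \<Longrightarrow> arrs ?s 4 x \<noteq> 0 \<longleftrightarrow> x \<in> hood E"
    using host by (auto simp: host_def)
  have idx: "val w (adj_index (Reg 1) (Reg 2)) ?old = a * n + b"
    "val w (adj_index (Reg 2) (Reg 1)) (set_cell 6 (a * n + b) 0 ?old) = b * n + a"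
    using regs(5) ne by (subst val_adj; simp)+
  let ?rest = "If (Op Eq (Reg 1) (Reg 4)) (isolate U 2)
     (If (Op Eq (Reg 2) (Reg 4)) (isolate U 1)
     (If (Read 4 (Reg 1))
        (If (Read 4 (Reg 2)) (Seq (Assign 8 (Reg 1)) (Seq (Assign 9 (Reg 2)) (call U 1))) Skip) Skip))"
  have iso: "wp w (isolate U r) ?Q t1 ?s"
    if r: "regs ?s r = u" and u: "{v, u} = {a, b}" and t1: "t1 \<le> t + 30"
      and co: "co_updates v nbs E (Delete a b) = map (Delete u) (co_pairs (hood E) E' u nbs)"
    for r u t1
  proof (rule wp_isolate[OF host emb r])
    have u': "u < n" "u \<noteq> v" "{v, u} \<in> E" using u ne ab(2) by (auto simp: doubleton_eq_iff insert_commute)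
    show "u < n" by fact
    show "scr ms = issued ms i @ map (Delete u) (co_pairs (hood E) E' u nbs) @ us"
      using us by (simp only: co)
    show "length (issued ms i) = p" by (simp add: p_def)
    show "t1 \<le> 11 * TT p + (X + 30)" using t t1 by simp
    have N: "neighbours E' v = neighbours E v - {u}"
      unfolding E' u[symmetric] by (simp add: neighbours_delete)
    have "u \<in> neighbours E v" using u' by (simp add: neighbours_def)
    then have card: "card (neighbours E v) = Suc (card (neighbours E' v))"
      unfolding N using finite_hood[OF sub] by (simp add: card_Suc_Diff1 del: card_Diff_insert card_Diff_singleton)
    have M: "hood E - {u} = hood E'" using N u' by auto
    fix t' s'
    assume "host (hood E - {u}) E' s'" "emb (S (p + length (co_pairs (hood E) E' u nbs))) s'"
      "t' \<le> 11 * TT (p + length (co_pairs (hood E) E' u nbs)) + (X + 30) + 30 * d + 30"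
    \<comment> \<open>The neighbourhood lost one vertex, which releases \<open>100 * (d + 1)\<close>
      units of potential and covers the \<open>30 * d + 60\<close> steps spent by the host.\<close>
    then show "?Q t' s'"
      unfolding p' co M card by (simp add: algebra_simps)
  qed
  consider "a = v" | "b = v" "a \<noteq> v" | "a \<noteq> v" "b \<noteq> v" by blast
  then have rest: "wp w ?rest ?Q t1 ?s" if t1: "t1 \<le> t + 22" for t1
  proof cases
    case 1
    with iso[of 2 b] regs t1 E' show ?thesis by simp
  next
    case 2
    with iso[of 1 a] regs t1 E' show ?thesis by (simp add: insert_commute)
  next
    case 3
    then have N: "neighbours E' v = neighbours E v" unfolding E' by (simp add: neighbours_delete)
    show ?thesis
    proof (cases "a \<in> neighbours E v \<and> b \<in> neighbours E v")
      case True
      then have co: "co_updates v nbs E (Delete a b) = [Insert a b]" using 3 by simp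
      have "wp w (call U 1) ?Q t2 (set_reg 9 b (set_reg 8 a ?s))" if "t2 \<le> t1 + 30" for t2
      proof (rule wp_call[where j = p and X = "X + 52"])
        show "p < N" "scr ms ! p = make_update 1 (regs (set_reg 9 b (set_reg 8 a ?s)) 8) (regs (set_reg 9 b (set_reg 8 a ?s)) 9)"
          using us co length_scr[of ms] by (auto simp: p_def nth_append simp del: length_scr)
        fix t' s'
        assume "emb (S (Suc p)) s'" "host_eq (set_reg 9 b (set_reg 8 a ?s)) s'" "t' \<le> 11 * TT (Suc p) + (X + 52)"
        then show "?Q t' s'"
          using host unfolding p' co N by (auto simp: host_def host_eq_def)
      qed (use emb t t1 that in auto)
      then show ?thesis using True 3 regs ne by simp
    next
      case False
      then have co: "co_updates v nbs E (Delete a b) = []" using 3 by simp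
      have *: "?Q t2 ?s" if "t2 \<le> t1 + 30" for t2
        using host emb t t1 that unfolding p' co N by simp
      have "wp w ?rest Q t1 ?s" if Q: "\<And>t2. t2 \<le> t1 + 30 \<Longrightarrow> Q t2 ?s" for Q
      proof -
        have "\<not> (regs ?s 1 = regs ?s 4)" "\<not> (regs ?s 2 = regs ?s 4)"
          "arrs ?s 4 (regs ?s 1) = 0 \<or> arrs ?s 4 (regs ?s 2) = 0"
          using False 3 regs(6)[of a] regs(6)[of b] ne unfolding regs by auto
        then show ?thesis using Q by auto
      qed
      from this[of ?Q, OF *] show ?thesis .
    qed
  qed
  have "wp w (host_update U) Q t ?old" if "\<And>t1. t1 \<le> t + 22 \<Longrightarrow> wp w ?rest Q t1 ?s" for Q
  proof -
    define R where "R = ?rest"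
    have cost: "cost (adj_index (Reg x) (Reg y)) = 5" for x y by (simp add: adj_index_def)
    have "host_update U = Seq (Store 6 (adj_index (Reg 1) (Reg 2)) (Const 0))
        (Seq (Store 6 (adj_index (Reg 2) (Reg 1)) (Const 0)) R)"
      by (simp add: host_update_def R_def)
    then show ?thesis
      using that[folded R_def] idx by (simp add: cost)
  qed
  with rest have "wp w (host_update U) ?Q t ?old" by blast
  then show ?thesis unfolding ab(1) .
qed

section \<open>Initialization of the host\<close>

lemma degree_le: "length (nbr_list (take i es) x) \<le> m"
  by (auto simp: nbr_list_def intro!: order_trans[OF length_filter_le])

lemma m_word: "x \<le> m + m \<Longrightarrow> Suc x < 2 ^ w"
  by (rule le_less_trans[OF _ word_lin]) simp

lemma wp_read_edges:
  assumes s: "regs s 1 = m" "regs s 3 = n" "regs s 6 = 0" "arrs s 3 = (\<lambda>_. 0)" "arrs s 6 = (\<lambda>_. 0)"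
    and inp: "\<And>i. i < m \<Longrightarrow> arrs s 1 i = fst (es ! i) \<and> arrs s 2 i = snd (es ! i)"
    and Q: "\<And>t' s'. \<forall>r. r \<notin> {6, 8, 9} \<longrightarrow> regs s' r = regs s r \<Longrightarrow>
      \<forall>x. x \<notin> {3, 6} \<longrightarrow> arrs s' x = arrs s x \<Longrightarrow> tape s' = tape s \<Longrightarrow>
      \<forall>x. arrs s' 3 x = length (nbr_list es x) \<Longrightarrow>
      \<forall>x<n. \<forall>y<n. arrs s' 6 (x * n + y) \<noteq> 0 \<longleftrightarrow> {x, y} \<in> edges es \<Longrightarrow>
      t' \<le> t + 60 * m + 60 \<Longrightarrow> Q t' s'"
  shows "wp w read_edges Q t s"
proof -
  define I where "I i t' s' \<longleftrightarrow> regs s' 6 = i \<and> (\<forall>r. r \<notin> {6, 8, 9} \<longrightarrow> regs s' r = regs s r) \<and>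
      (\<forall>x. x \<notin> {3, 6} \<longrightarrow> arrs s' x = arrs s x) \<and> tape s' = tape s \<and>
      (\<forall>x. arrs s' 3 x = length (nbr_list (take i es) x)) \<and>
      (\<forall>x<n. \<forall>y<n. arrs s' 6 (x * n + y) \<noteq> 0 \<longleftrightarrow> {x, y} \<in> edges (take i es)) \<and>
      t' \<le> t + 60 * i" for i t' and s' :: state
  show ?thesis
    unfolding read_edges_def
  proof (rule wp_While[where I = I and N = m])
    show "I 0 t s" using s by (simp add: I_def)
  next
    fix i t' s' assume i: "i < m" and I: "I i t' s'"
    obtain a b where ab: "es ! i = (a, b)" by (cases "es ! i")
    then have "{a, b} \<in> edges es" using i unfolding edges_def by (force simp: in_set_conv_nth)
    then have ne: "a < n" "b < n" "a \<noteq> b" using edge_listD[OF es] by blast+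
    have take: "take (Suc i) es = take i es @ [(a, b)]" using i ab by (simp add: take_Suc_conv_app_nth)
    have edges: "edges (take (Suc i) es) = insert {a, b} (edges (take i es))"
      unfolding take by (simp add: edges_def)
    have s': "regs s' 6 = i" "regs s' 3 = n" "regs s' 1 = m" "arrs s' (Suc 0) i = a" "arrs s' 2 i = b"
      using I s inp[OF i] ab by (auto simp: I_def)
    have mods [simp]: "Suc i mod 2 ^ w = Suc i" using m_word[of i] i by simp
    have deg: "Suc (arrs s' 3 x) mod 2 ^ w = Suc (length (nbr_list (take i es) x))" for x
      using m_word[OF trans_le_add1[OF degree_le, of i x m]] I by (simp add: I_def mult_2)
    have idx: "val w (adj_index (Reg x) (Reg y)) s1 = val w (Reg x) s1 * n + val w (Reg y) s1"
      if "regs s1 3 = n" "regs s1 x < n" "regs s1 y < n" for x y s1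
      using val_adj[of s1 "Reg x" "Reg y"] that by simp
    have c: "cost (adj_index (Reg x) (Reg y)) = 5" for x y by (simp add: adj_index_def)
    have I': "I (Suc i) t1 s1"
      if "s1 = set_reg 6 (Suc i) (set_cell 6 (b * n + a) 1 (set_cell 6 (a * n + b) 1
         (set_cell 3 b (Suc (length (nbr_list (take i es) b))) (set_cell 3 a (Suc (length (nbr_list (take i es) a)))
         (set_reg 9 b (set_reg 8 a s'))))))" "t1 \<le> t' + 60" for t1 s1
    proof -
      have "length (nbr_list (take (Suc i) es) x) = length (nbr_list (take i es) x) + of_bool (x = a \<or> x = b)" for x
        unfolding take by auto
      then show ?thesis
        using I ne that(2) unfolding I_def edges that(1) by (auto simp: index_eq doubleton_eq_iff)
    qed
    show "val w (Op Less (Reg 6) (Reg 1)) s' \<noteq> 0 \<and> wp w (Seq (Assign 8 (Read 1 (Reg 6))) (Seq (Assign 9 (Read 2 (Reg 6)))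
     (Seq (Store 3 (Reg 8) (Op Add (Read 3 (Reg 8)) (Const 1)))
     (Seq (Store 3 (Reg 9) (Op Add (Read 3 (Reg 9)) (Const 1)))
     (Seq (Store 6 (adj_index (Reg 8) (Reg 9)) (Const 1))
     (Seq (Store 6 (adj_index (Reg 9) (Reg 8)) (Const 1)) (incr 6))))))) (I (Suc i))
      (t' + (cost (Op Less (Reg 6) (Reg 1)) + 1)) s'"
      using s' ne i I'[OF refl] by (simp add: deg idx c incr_def)
  next
    fix t' s' assume "I m t' s'"
    then show "val w (Op Less (Reg 6) (Reg 1)) s' = 0 \<and> Q (t' + (cost (Op Less (Reg 6) (Reg 1)) + 1)) s'"
      using s by (auto simp: I_def intro!: Q)
  qed
qed

text \<open>One round costs 12 steps for the guard and 4 for the increment, and there are at most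
  \<open>2 * m\<close> rounds; this gives \<open>32 * m\<close>.\<close>

lemma wp_find_pivot:
  assumes s: "regs s 1 = m" "regs s 4 = 0" and deg: "\<forall>x. arrs s 3 x = length (nbr_list es x)"
    and Q: "\<And>t'. t' \<le> t + 32 * m + 60 \<Longrightarrow> Q t' (set_reg 4 v s)"
  shows "wp w find_pivot Q t s"
proof -
  define I where "I i t' s' \<longleftrightarrow> s' = set_reg 4 i s \<and> t' \<le> t + 16 * i" for i t' s'
  have "x * (x + 1) < 2 ^ w" if "x \<le> m" for x
  proof -
    have "x * (x + 1) \<le> (n + m + 2) * (n + m + 2)" using that by (intro mult_mono) auto
    also have "\<dots> < 4 * ((n + m + 2) * (n + m + 2))" by (rule n_less_m_mult_n) auto
    also have "\<dots> \<le> 2 ^ w" using word2 by (simp only: mult.assoc)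
    finally show ?thesis .
  qed
  from this[OF degree_le[of m]] have mod1: "length (nbr_list es x) * (length (nbr_list es x) + 1) mod 2 ^ w =
      length (nbr_list es x) * (length (nbr_list es x) + 1)" for x by simp
  have mod2: "Suc (length (nbr_list es x)) mod 2 ^ w = Suc (length (nbr_list es x))" for x
    using m_word[OF trans_le_add1[OF degree_le, of m x m]] by (simp add: mult_2)
  have mod3: "(m + m) mod 2 ^ w = m + m" using m_word[of "m + m"] by simp
  have guard: "val w (Op Less (Op Add (Reg 1) (Reg 1))
       (Op Mul (Read 3 (Reg 4)) (Op Add (Read 3 (Reg 4)) (Const 1)))) (set_reg 4 i s) =
     of_bool (2 * m < length (nbr_list es i) * (length (nbr_list es i) + 1))" for i
    using s deg mod1 mod2 mod3 by (simp add: mult_2)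
  show ?thesis
    unfolding find_pivot_def
  proof (rule wp_While[where I = I and N = v])
    have "set_reg 4 0 s = s" using s(2) by (auto simp: set_reg_def fun_upd_idem)
    then show "I 0 t s" by (simp add: I_def)
  next
    fix i t' s' assume i: "i < v" and I: "I i t' s'"
    have "Suc i mod 2 ^ w = Suc i" using m_word[of i] i pivot(3)[OF es] by simp
    moreover have "set_reg 4 (Suc i) (set_reg 4 i s) = set_reg 4 (Suc i) s" by (simp add: set_reg_def)
    ultimately show "val w (Op Less (Op Add (Reg 1) (Reg 1))
       (Op Mul (Read 3 (Reg 4)) (Op Add (Read 3 (Reg 4)) (Const 1)))) s' \<noteq> 0 \<and>
       wp w (incr 4) (I (Suc i)) (t' + (cost (Op Less (Op Add (Reg 1) (Reg 1))
       (Op Mul (Read 3 (Reg 4)) (Op Add (Read 3 (Reg 4)) (Const 1)))) + 1)) s'"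
      using I pivot(4)[OF es i] unfolding I_def by (simp only: guard) (simp add: incr_def)
  next
    fix t' s' assume I: "I v t' s'"
    have "t' \<le> t + 32 * m" using I pivot(3)[OF es] by (simp add: I_def)
    then show "val w (Op Less (Op Add (Reg 1) (Reg 1))
       (Op Mul (Read 3 (Reg 4)) (Op Add (Read 3 (Reg 4)) (Const 1)))) s' = 0 \<and>
       Q (t' + (cost (Op Less (Op Add (Reg 1) (Reg 1))
       (Op Mul (Read 3 (Reg 4)) (Op Add (Read 3 (Reg 4)) (Const 1)))) + 1)) s'"
      using I pivot(1)[OF es] unfolding I_def by (simp only: guard) (simp add: Q)
  qed
qed

lemma wp_list_nbrs:
  assumes s: "regs s 1 = m" "regs s 4 = v" "regs s 5 = 0" "regs s 6 = 0" "\<forall>x. arrs s 4 x \<noteq> 0 \<longleftrightarrow> x = v"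
    and inp: "\<And>i. i < m \<Longrightarrow> arrs s 1 i = fst (es ! i) \<and> arrs s 2 i = snd (es ! i)"
    and Q: "\<And>t' s'. \<forall>r. r \<notin> {5, 6, 9} \<longrightarrow> regs s' r = regs s r \<Longrightarrow>
      \<forall>x. x \<notin> {4, 5} \<longrightarrow> arrs s' x = arrs s x \<Longrightarrow> tape s' = tape s \<Longrightarrow> regs s' 5 = d \<Longrightarrow>
      \<forall>x. arrs s' 4 x \<noteq> 0 \<longleftrightarrow> x = v \<or> x \<in> set nbs \<Longrightarrow> \<forall>j<d. arrs s' 5 j = nbs ! j \<Longrightarrow>
      t' \<le> t + 40 * m + 60 \<Longrightarrow> Q t' s'"
  shows "wp w list_nbrs Q t s"
proof -
  define I where "I i t' s' \<longleftrightarrow> regs s' 6 = i \<and> (\<forall>r. r \<notin> {5, 6, 9} \<longrightarrow> regs s' r = regs s r) \<and>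
      (\<forall>x. x \<notin> {4, 5} \<longrightarrow> arrs s' x = arrs s x) \<and> tape s' = tape s \<and>
      regs s' 5 = length (nbr_list (take i es) v) \<and>
      (\<forall>x. arrs s' 4 x \<noteq> 0 \<longleftrightarrow> x = v \<or> x \<in> set (nbr_list (take i es) v)) \<and>
      (\<forall>j<length (nbr_list (take i es) v). arrs s' 5 j = nbr_list (take i es) v ! j) \<and>
      t' \<le> t + 40 * i" for i t' and s' :: state
  show ?thesis
    unfolding list_nbrs_def
  proof (rule wp_While[where I = I and N = m])
    show "I 0 t s" using s by (simp add: I_def)
  next
    fix i t' s' assume i: "i < m" and I: "I i t' s'"
    obtain a b where ab: "es ! i = (a, b)" by (cases "es ! i")
    have take: "take (Suc i) es = take i es @ [(a, b)]" using i ab by (simp add: take_Suc_conv_app_nth)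
    have s': "regs s' 6 = i" "regs s' 4 = v" "regs s' 1 = m" "arrs s' (Suc 0) i = a" "arrs s' 2 i = b"
      "regs s' 5 = length (nbr_list (take i es) v)"
      using I s inp[OF i] ab by (auto simp: I_def)
    have mods [simp]: "Suc i mod 2 ^ w = Suc i" using m_word[of i] i by simp
    have deg: "Suc (length (nbr_list (take i es) v)) mod 2 ^ w = Suc (length (nbr_list (take i es) v))"
      using m_word[OF trans_le_add1[OF degree_le, of i v m]] by (simp add: mult_2)
    have push: "I (Suc i) t1 s1"
      if "s1 = set_reg 6 (Suc i) (set_reg 5 (Suc (length (nbr_list (take i es) v))) (set_cell 4 x 1
         (set_cell 5 (length (nbr_list (take i es) v)) x (set_reg 9 x s'))))" "t1 \<le> t' + 40"
        "nbr_list (take (Suc i) es) v = nbr_list (take i es) v @ [x]" for t1 s1 x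
      using I that(2) unfolding I_def that(3) that(1) by (auto simp: nth_append less_Suc_eq)
    have skip: "I (Suc i) t1 (set_reg 6 (Suc i) s')"
      if "t1 \<le> t' + 40" "nbr_list (take (Suc i) es) v = nbr_list (take i es) v" for t1
      using I that(1) unfolding I_def that(2) by auto
    show "val w (Op Less (Reg 6) (Reg 1)) s' \<noteq> 0 \<and>
      wp w (Seq (If (Op Eq (Read 1 (Reg 6)) (Reg 4)) (push_nbr 2)
             (If (Op Eq (Read 2 (Reg 6)) (Reg 4)) (push_nbr 1) Skip)) (incr 6)) (I (Suc i))
      (t' + (cost (Op Less (Reg 6) (Reg 1)) + 1)) s'"
    proof -
      consider "a = v" | "a \<noteq> v" "b = v" | "a \<noteq> v" "b \<noteq> v" by blast
      then show ?thesis
      proof cases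
        case 1
        with s' i push[OF refl, of _ b] show ?thesis
          by (simp add: deg incr_def push_nbr_def take)
      next
        case 2
        with s' i push[OF refl, of _ a] show ?thesis
          by (simp add: deg incr_def push_nbr_def take)
      next
        case 3
        with s' i skip show ?thesis by (simp add: incr_def take)
      qed
    qed
  next
    fix t' s' assume "I m t' s'"
    then show "val w (Op Less (Reg 6) (Reg 1)) s' = 0 \<and> Q (t' + (cost (Op Less (Reg 6) (Reg 1)) + 1)) s'"
      using s by (auto simp: I_def intro!: Q)
  qed
qed

lemma wp_insert_pairs:
  defines "E \<equiv> edges es"
  defines "p \<equiv> \<lambda>i. length (initial_updates v E nbs i)"
  assumes s: "host (hood E) E s" "emb (S 0) s" "regs s 6 = 0"
    and t: "t \<le> 11 * TT 0 + X"
    and Q: "\<And>t' s'. host (hood E) E s' \<Longrightarrow> emb (S (p d)) s' \<Longrightarrow>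
      t' \<le> 11 * TT (p d) + X + 100 * m + 100 \<Longrightarrow> Q t' s'"
  shows "wp w (insert_pairs U) Q t s"
proof -
  define I where "I i t' s' \<longleftrightarrow> regs s' 6 = i \<and> host (hood E) E s' \<and> emb (S (p i)) s' \<and>
      t' \<le> 11 * TT (p i) + X + 30 * (d + 1) * i" for i t' s'
  have prefix: "\<exists>us. scr ms = initial_updates v E nbs i @ us" if "i \<le> d" for i
  proof -
    have "\<exists>us. initial_updates v E nbs j = initial_updates v E nbs i @ us" if "i \<le> j" for j
      using that by (induction j rule: dec_induct) (auto simp: initial_updates_Suc)
    from this[OF that] scr_prefix[of 0 ms] show ?thesis by (auto simp: E_def)
  qed
  show ?thesis
    unfolding insert_pairs_def
  proof (rule wp_While[where I = I and N = d])
    show "I 0 t s" using s t by (simp add: I_def p_def initial_updates_def)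
  next
    fix i t' s' assume i: "i < d" and I: "I i t' s'"
    let ?u = "nbs ! i"
    have u: "?u < n" using nbr_list(3)[OF es, of ?u v] i by simp
    have s': "regs s' 6 = i" "regs s' 5 = d" "arrs s' 5 i = ?u" "host (hood E) E s'" "emb (S (p i)) s'"
      "t' \<le> 11 * TT (p i) + X + 30 * (d + 1) * i"
      using I i by (auto simp: I_def host_def)
    obtain us where us: "scr ms = initial_updates v E nbs i @
        map (Insert ?u) (co_pairs (hood E) E ?u (take i nbs)) @ us"
      using prefix[of "Suc i"] i by (auto simp: initial_updates_Suc)
    have p: "p (Suc i) = p i + length (co_pairs (hood E) E ?u (take i nbs))"
      by (simp add: p_def initial_updates_Suc)
    have "d * 1 \<le> d * (d + 1)" by (intro mult_left_mono) auto
    with d_le have "d \<le> 2 * m" by linarith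
    then have mods [simp]: "Suc i mod 2 ^ w = Suc i" using m_word[of i] i by simp
    have scan: "wp w (scan U 1) (wp w (incr 6) (I (Suc i))) t1 (set_reg 10 i (set_reg 8 ?u s'))"
      if t1: "t1 \<le> t' + 12" for t1
    proof (rule wp_scan[where M = "hood E" and E = E and p = "p i" and b = i and u = ?u and post = us
          and pre = "initial_updates v E nbs i" and X = "X + 30 * (d + 1) * i + 12"])
      show "host (hood E) E (set_reg 10 i (set_reg 8 ?u s'))" using s' by (simp add: host_def)
    next
      fix t2 s2
      assume s2: "emb (S (p i + length (co_pairs (hood E) E ?u (take i nbs)))) s2"
        "\<forall>r<14. r \<notin> {7, 9} \<longrightarrow> regs s2 r = regs (set_reg 10 i (set_reg 8 ?u s')) r"
        "\<forall>x. 0 < x \<and> x < 16 \<longrightarrow> arrs s2 x = arrs (set_reg 10 i (set_reg 8 ?u s')) x"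
        "t2 \<le> 11 * TT (p i + length (co_pairs (hood E) E ?u (take i nbs))) + (X + 30 * (d + 1) * i + 12) + 30 * i + 10"
      have "host (hood E) E (set_reg 6 (Suc i) s2)" using s'(4) s2(2,3) by (simp add: host_def)
      then show "wp w (incr 6) (I (Suc i)) t2 s2"
        using s2 s' i unfolding I_def p by (simp add: incr_def algebra_simps)
    qed (use s' u us i t1 in \<open>auto simp: p_def\<close>)
    show "val w (Op Less (Reg 6) (Reg 5)) s' \<noteq> 0 \<and>
      wp w (Seq (Assign 8 (Read 5 (Reg 6))) (Seq (Assign 10 (Reg 6)) (Seq (scan U 1) (incr 6)))) (I (Suc i))
      (t' + (cost (Op Less (Reg 6) (Reg 5)) + 1)) s'"
      using s' i scan by simp
  next
    fix t' s' assume I: "I d t' s'"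
    \<comment> \<open>The choice of the pivot makes the quadratic cost of the nested loops linear in
      \<open>m\<close>.\<close>
    have "30 * (d + 1) * d \<le> 60 * m" using d_le by (simp add: algebra_simps)
    then have "t' \<le> 11 * TT (p d) + X + 60 * m" "regs s' 6 = d" "regs s' 5 = d"
      "host (hood E) E s'" "emb (S (p d)) s'"
      using I unfolding I_def by (auto simp: host_def)
    then show "val w (Op Less (Reg 6) (Reg 5)) s' = 0 \<and> Q (t' + (cost (Op Less (Reg 6) (Reg 5)) + 1)) s'"
      by (auto intro!: Q)
  qed
qed

lemma wp_host_init:
  "wp w (host_init (init_prog A) U) (\<lambda>t s. host (hood (edges es)) (edges es) s \<and>
      emb (S (length (issued ms 0))) s \<and> t \<le> 11 * TT (length (issued ms 0)) + 300 * m + 500)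
    0 (initial_state n es \<omega>)"
proof -
  let ?Q = "\<lambda>t s. host (hood (edges es)) (edges es) s \<and>
      emb (S (length (issued ms 0))) s \<and> t \<le> 11 * TT (length (issued ms 0)) + 300 * m + 500"
  have TT0: "TT 0 = tt 0" by (simp add: TT_def)
  have guest: "wp w (embed_com (init_prog A)) (wp w (Seq (Assign 6 (Const 0)) (insert_pairs U)) ?Q) t s"
    if host: "host (hood (edges es)) (edges es) s" and emb: "emb (initial_state n [] \<omega>) s"
      and t: "t \<le> 200 * m + 300" for t s
  proof -
    from exec_embed[OF guest_init emb] obtain t' s' where
      1: "exec w (embed_com (init_prog A)) s t' s'" "t' \<le> 5 * tt 0" "emb (S 0) s'" "host_eq s s'"
      by blast
    have "wp w (insert_pairs U) ?Q (t + t' + 2) (set_reg 6 0 s')"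
    proof (rule wp_insert_pairs[where X = "t + 2"])
      show "host (hood (edges es)) (edges es) (set_reg 6 0 s')"
        using host 1(4) by (simp add: host_def host_eq_def)
    qed (use 1 t in \<open>auto simp: TT0\<close>)
    then show ?thesis by (intro wpI[OF 1(1)]) simp
  qed
  let ?start = "set_reg 3 n (initial_state n es \<omega>)"
  let ?tail = "Seq (Assign 16 (Reg 3)) (Seq (embed_com (init_prog A)) (Seq (Assign 6 (Const 0)) (insert_pairs U)))"
  let ?mid = "Seq (Store 4 (Reg 4) (Const 1)) (Seq (Assign 6 (Const 0)) (Seq list_nbrs ?tail))"
  have "wp w (Seq read_edges (Seq find_pivot ?mid)) ?Q 2 ?start"
    unfolding wp_Seq[of _ read_edges]
  proof (rule wp_read_edges)
    fix t1 and s1 :: state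
    assume r1: "\<forall>r. r \<notin> {6, 8, 9} \<longrightarrow> regs s1 r = regs ?start r"
      "\<forall>x. x \<notin> {3, 6} \<longrightarrow> arrs s1 x = arrs ?start x" "tape s1 = tape ?start"
      "\<forall>x. arrs s1 3 x = length (nbr_list es x)"
      "\<forall>x<n. \<forall>y<n. arrs s1 6 (x * n + y) \<noteq> 0 \<longleftrightarrow> {x, y} \<in> edges es" "t1 \<le> 2 + 60 * m + 60"
    show "wp w (Seq find_pivot ?mid) ?Q t1 s1"
      unfolding wp_Seq[of _ find_pivot]
    proof (rule wp_find_pivot[OF _ _ r1(4)])
      show "regs s1 1 = m" "regs s1 4 = 0" using r1 by (simp_all add: initial_state_def)
      fix t2 assume t2: "t2 \<le> t1 + 32 * m + 60"
      let ?time = "Suc (Suc (Suc (Suc (Suc t2))))"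
      let ?marked = "set_reg 6 0 (set_cell 4 v 1 (set_reg 4 v s1))"
      have "wp w (Seq list_nbrs ?tail) ?Q ?time ?marked"
        unfolding wp_Seq[of _ list_nbrs]
      proof (rule wp_list_nbrs)
        fix t4 and s4 :: state
        assume r4: "\<forall>r. r \<notin> {5, 6, 9} \<longrightarrow> regs s4 r = regs ?marked r"
          "\<forall>x. x \<notin> {4, 5} \<longrightarrow> arrs s4 x = arrs ?marked x" "tape s4 = tape ?marked" "regs s4 5 = d"
          "\<forall>x. arrs s4 4 x \<noteq> 0 \<longleftrightarrow> x = v \<or> x \<in> set nbs" "\<forall>j<d. arrs s4 5 j = nbs ! j"
          "t4 \<le> ?time + 40 * m + 60"
        have "host (hood (edges es)) (edges es) (set_reg 16 n s4)"
          using r1 r4 nbr_list(1)[OF es] by (auto simp: host_def)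
        \<comment> \<open>So far the host has written to no register or array from 16 on except
          register 16, and array 0 is untouched, so the guest sees its start on the empty
          graph.\<close>
        moreover have "emb (initial_state n [] \<omega>) (set_reg 16 n s4)"
          using r1 r4 by (auto simp: emb_def initial_state_def)
        moreover have "Suc (Suc t4) \<le> 200 * m + 300"
          using r1 r4 t2 by simp
        ultimately have "wp w (embed_com (init_prog A)) (wp w (Seq (Assign 6 (Const 0)) (insert_pairs U)) ?Q)
            (Suc (Suc t4)) (set_reg 16 n s4)"
          by (rule guest)
        moreover have "regs s4 3 = n" using r1 r4 by simp
        ultimately show "wp w ?tail ?Q t4 s4"
          by (simp only: wp_Seq wp_Assign val.simps cost.simps add_Suc_right add_0_right One_nat_def)
      qed (use r1 in \<open>auto simp: initial_state_def\<close>)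
      then show "wp w ?mid ?Q t2 (set_reg 4 v s1)"
        by (simp del: wp_Seq add: wp_Seq[of _ "Store _ _ _"] wp_Seq[of _ "Assign _ _"])
    qed
  qed (simp_all add: initial_state_def)
  then show ?thesis
    unfolding host_init_def wp_Seq[of _ "Assign _ _"] by (simp del: wp_Seq add: initial_state_def numeral_2_eq_2)
qed

section \<open>The complete run of the host\<close>

lemma host_output:
  assumes "host (hood E) E s" "emb (S p) s" "p \<le> N"
  shows "output_set n s = ms ! p \<inter> hood E"
  using assms unfolding ms(2)[OF assms(3)] output_set_def host_def emb_def by auto

text \<open>\<open>cliques ms (Suc i)\<close> holds the \<open>i + 1\<close> outputs up to round
  \<open>i\<close>, the initial one included. The summand \<open>100 * (d + 1) * d\<close> is the
  initial potential, and each round adds 100 to the host's share.\<close>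

lemma host_run:
  "i \<le> k \<Longrightarrow> \<exists>t s. run w (host_algorithm A) n es \<sigma> \<omega> t s (cliques ms (Suc i)) \<and>
     host (hood (host_graph ms i)) (host_graph ms i) s \<and> emb (S (length (issued ms i))) s \<and>
     t + 100 * (d + 1) * card (neighbours (host_graph ms i) v)
       \<le> 11 * TT (length (issued ms i)) + (300 * m + 500 + 100 * i + 100 * (d + 1) * d)"
proof (induction i)
  case 0
  obtain t s where 1: "exec w (host_init (init_prog A) U) (initial_state n es \<omega>) t s"
    and 2: "host (hood (edges es)) (edges es) s" "emb (S (length (issued ms 0))) s"
      "t \<le> 11 * TT (length (issued ms 0)) + 300 * m + 500"
    using wp_host_init unfolding wp_def by auto
  have "output_set n s = ms ! length (issued ms 0) \<inter> hood (host_graph ms 0)"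
    using host_output[OF 2(1,2)] length_issued[of 0 ms] by simp
  then have "[output_set n s] = cliques ms (Suc 0)" by (simp add: cliques_Suc)
  moreover have "run w (host_algorithm A) n es \<sigma> \<omega> t s [output_set n s]"
    using 1 by (intro run.init) (simp add: host_algorithm_def)
  moreover have "card (neighbours (edges es) v) = d"
    using distinct_card nbr_list[OF es] by metis
  ultimately show ?case using 2 by (intro exI[of _ t] exI[of _ s]) simp
next
  case (Suc i)
  let ?X = "300 * m + 500 + 100 * i + 100 * (d + 1) * d"
  let ?c = "\<lambda>i. 100 * (d + 1) * card (neighbours (host_graph ms i) v)"
  from Suc obtain t s where IH: "run w (host_algorithm A) n es \<sigma> \<omega> t s (cliques ms (Suc i))"
    "host (hood (host_graph ms i)) (host_graph ms i) s" "emb (S (length (issued ms i))) s"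
    "t + ?c i \<le> 11 * TT (length (issued ms i)) + ?X"
    by auto
  have i: "i < k" using Suc by simp
  have "neighbours (host_graph ms i) v \<subseteq> set nbs"
    using host_graph_subset[of i ms] i nbr_list(1)[OF es] by (auto simp: neighbours_def)
  from card_mono[OF _ this] have "card (neighbours (host_graph ms i) v) \<le> d"
    using distinct_card[OF nbr_list(2)[OF es]] by simp
  then have "?c i \<le> 100 * (d + 1) * d" by (rule mult_left_mono) simp
  \<comment> \<open>Ensures that the natural subtraction \<open>?X - ?c i\<close> below does not
    truncate.\<close>
  then have c: "?c i \<le> ?X" by linarith
  have "t \<le> 11 * TT (length (issued ms i)) + (?X - ?c i)" using IH(4) c by linarith
  from wp_host_update[OF i IH(2,3) this] c
  obtain t' s' where 1: "exec w (host_update U) (pass_update (\<sigma> (cliques ms (Suc i))) s) t' s'"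
    and 2: "host (hood (host_graph ms (Suc i))) (host_graph ms (Suc i)) s'" "emb (S (length (issued ms (Suc i)))) s'"
      "t + t' + ?c (Suc i) \<le> 11 * TT (length (issued ms (Suc i))) + (?X - ?c i) + 100 + ?c i"
    unfolding wp_def by auto
  have "output_set n s' = ms ! length (issued ms (Suc i)) \<inter> hood (host_graph ms (Suc i))"
    using host_output[OF 2(1,2)] length_issued[OF Suc.prems, of ms] .
  then have "cliques ms (Suc i) @ [output_set n s'] = cliques ms (Suc (Suc i))"
    by (simp only: cliques_Suc[of ms "Suc i"])
  moreover have "run w (host_algorithm A) n es \<sigma> \<omega> (t + t') s' (cliques ms (Suc i) @ [output_set n s'])"
    using 1 IH(1) by (intro run.step) (simp_all add: host_algorithm_def)
  moreover have "t + t' + ?c (Suc i) \<le> 11 * TT (length (issued ms (Suc i))) +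
      (300 * m + 500 + 100 * Suc i + 100 * (d + 1) * d)"
  proof -
    have "x \<le> y + (X - c) + 100 + c \<Longrightarrow> c \<le> X \<Longrightarrow> x \<le> y + (X + 100)" for x y X c :: nat by simp
    from this[OF 2(3) c] show ?thesis by simp
  qed
  ultimately show ?case using 2(1,2) by (intro exI[of _ "t + t'"] exI[of _ s']) simp
qed

lemma TT_mono: "i \<le> j \<Longrightarrow> TT i \<le> TT j"
  unfolding TT_def by (rule sum_mono2) auto

text \<open>Initialization and each of the \<open>N\<close> updates take at least one step. This
  turns the host's O(m) overhead into a multiple of the guest's time, so the final bound has no
  additive term.\<close>

lemma TT_N: "N < TT N"
proof -
  have "0 < tt l" if "l \<le> N" for l
    using that exec_pos[OF guest_init] exec_pos[OF guest_update[of "l - 1"]] by (cases l) auto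
  then have "(\<Sum>l\<le>N. 1) \<le> TT N" unfolding TT_def by (intro sum_mono) (simp add: Suc_leI)
  then show ?thesis by simp
qed

text \<open>The host's share is at most \<open>600 * m + 500\<close>, which is below
  \<open>500 * TT N\<close> since \<open>TT N\<close> is at least \<open>5 * m + 1\<close>; with the
  factor 11 for guest calls this makes 511.\<close>

lemma host_run_total:
  "\<exists>t s. run w (host_algorithm A) n es \<sigma> \<omega> t s (cliques ms (Suc k)) \<and> t \<le> 511 * TT N"
proof -
  from host_run[of k] obtain t s where 1: "run w (host_algorithm A) n es \<sigma> \<omega> t s (cliques ms (Suc k))"
    and t: "t \<le> 11 * TT (length (issued ms k)) + (300 * m + 500 + 100 * k + 100 * (d + 1) * d)"
    by fastforce
  have "100 * (d + 1) * d \<le> 200 * m" using d_le by (simp add: algebra_simps)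
  moreover have "100 * k \<le> 100 * m" using k_le by simp
  moreover have "TT (length (issued ms k)) \<le> TT N" by (rule TT_mono[OF length_issued]) simp
  moreover have "5 * m < TT N" using TT_N N by simp
  ultimately have "t \<le> 511 * TT N" using t by linarith
  with 1 show ?thesis by blast
qed

lemma cliques_prefix: "i \<le> j \<Longrightarrow> \<exists>cs. cliques ms j = cliques ms i @ cs"
proof (induction j rule: dec_induct)
  case (step j)
  then obtain cs where "cliques ms j = cliques ms i @ cs" by blast
  then show ?case unfolding cliques_Suc by simp
qed simp

lemma host_correct:
  assumes "\<And>j. j \<le> N \<Longrightarrow> maximal_indep n (graph_at \<tau> {} ms j) (ms ! j)" "i \<le> k"
  shows "maximal_clique n (graph_at \<sigma> (edges es) (cliques ms (Suc k)) i) (cliques ms (Suc k) ! i)"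
proof -
  have l: "length (issued ms i) \<le> N" by (rule length_issued[OF assms(2)])
  have "Suc i \<le> Suc k" using assms(2) by simp
  from cliques_prefix[OF this] obtain cs where "cliques ms (Suc k) = cliques ms (Suc i) @ cs" by blast
  then have cs: "cliques ms (Suc k) =
      cliques ms i @ (ms ! length (issued ms i) \<inter> hood (host_graph ms i)) # cs"
    by (simp add: cliques_Suc[of ms i])
  have "graph_at \<sigma> (edges es) (cliques ms (Suc k)) i = host_graph ms i"
    unfolding cs by (simp add: graph_at_append)
  moreover have "cliques ms (Suc k) ! i = ms ! length (issued ms i) \<inter> hood (host_graph ms i)"
    unfolding cs by (simp add: nth_append)
  moreover have "length (issued ms i) < length ms" using l ms(1) by simp
  ultimately show ?thesis
    using maximal_clique_output[OF assms(2) _ assms(1)[OF l]] by simp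
qed

end

text \<open>Unrolls the inductive run into states and step counts indexed by the update, the form
  required by \<open>guest_trace\<close>.\<close>

lemma run_trace:
  assumes "run w A n es \<sigma> \<omega> t s os"
  shows "os \<noteq> [] \<and> (\<exists>S tt. exec w (init_prog A) (initial_state n es \<omega>) (tt 0) (S 0) \<and>
    (\<forall>j. Suc j < length os \<longrightarrow>
       exec w (update_prog A) (pass_update (\<sigma> (take (Suc j) os)) (S j)) (tt (Suc j)) (S (Suc j))) \<and>
    (\<forall>j<length os. os ! j = output_set n (S j)) \<and> t = sum tt {..<length os} \<and> s = S (length os - 1))"
  using assms
proof induction
  case (init t s)
  then show ?case by (intro conjI exI[of _ "\<lambda>_. s"] exI[of _ "\<lambda>_. t"]) auto
next
  case (step t s os t' s')
  then obtain S tt where IH: "os \<noteq> []" "exec w (init_prog A) (initial_state n es \<omega>) (tt 0) (S 0)"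
    "\<And>j. Suc j < length os \<Longrightarrow>
       exec w (update_prog A) (pass_update (\<sigma> (take (Suc j) os)) (S j)) (tt (Suc j)) (S (Suc j))"
    "\<And>j. j < length os \<Longrightarrow> os ! j = output_set n (S j)" "t = sum tt {..<length os}" "s = S (length os - 1)"
    by blast
  let ?S = "S(length os := s')" and ?tt = "tt(length os := t')"
  have upd: "exec w (update_prog A) (pass_update (\<sigma> (take (Suc j) (os @ [output_set n s']))) (?S j)) (?tt (Suc j)) (?S (Suc j))"
    if "Suc j < length (os @ [output_set n s'])" for j
  proof (cases "Suc j < length os")
    case True
    with IH(3) show ?thesis by simp
  next
    case False
    with that have j: "length os = Suc j" by simp
    then have "take (Suc j) (os @ [output_set n s']) = os" "?S j = s" "?tt (Suc j) = t'" "?S (Suc j) = s'"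
      using IH(6) by auto
    with step.hyps(2) show ?thesis by simp
  qed
  have "exec w (init_prog A) (initial_state n es \<omega>) (?tt 0) (?S 0)" using IH(1,2) by simp
  moreover have "(os @ [output_set n s']) ! j = output_set n (?S j)" if "j < length (os @ [output_set n s'])" for j
    using that IH(4)[of j] by (cases "j = length os") (auto simp: nth_append)
  moreover have "t + t' = sum ?tt {..<length (os @ [output_set n s'])}"
    unfolding IH(5) by simp
  moreover have "s' = ?S (length (os @ [output_set n s']) - 1)" by simp
  ultimately show ?case
    using upd by (intro conjI exI[of _ ?S] exI[of _ ?tt] allI impI) simp_all
qed

text \<open>The time bound covers every guest run of full length, even an incorrect one, and
  correctness is a separate implication. The guarantee \<open>Expected\<close> needs this split: it
  bounds the integral of the time over all tapes, but correctness holds only almost surely.\<close>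

lemma host_simulation:
  fixes n es \<sigma> k
  defines "N \<equiv> 5 * length es"
  defines "\<tau> \<equiv> guest_adversary \<sigma> (edges es) (pivot es) (nbr_list es (pivot es)) k N"
  assumes es: "edge_list n es" and legal: "legal_adversary deletions n (edges es) k \<sigma>"
    and word: "(n + length es + 2) ^ 4 \<le> 2 ^ w"
    and run: "run w A n [] \<tau> \<omega> t s ms" "length ms = Suc N"
  shows "\<exists>t' s' cs. run w (host_algorithm A) n es \<sigma> \<omega> t' s' cs \<and> length cs = Suc k \<and> t' \<le> 511 * t \<and>
    ((\<forall>j\<le>N. maximal_indep n (graph_at \<tau> {} ms j) (ms ! j)) \<longrightarrow>
     (\<forall>i\<le>k. maximal_clique n (graph_at \<sigma> (edges es) cs i) (cs ! i)))"
proof -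
  interpret decremental n es \<sigma> k N
    by unfold_locales (use es legal N_def in auto)
  from run_trace[OF run(1)] run(2) obtain S tt where
    tr: "exec w (init_prog A) (initial_state n [] \<omega>) (tt 0) (S 0)"
    "\<And>j. j < N \<Longrightarrow> exec w (update_prog A) (pass_update (\<tau> (take (Suc j) ms)) (S j)) (tt (Suc j)) (S (Suc j))"
    "\<And>j. j \<le> N \<Longrightarrow> ms ! j = output_set n (S j)" "t = sum tt {..<Suc N}"
    by (auto simp: less_Suc_eq_le)
  interpret guest_trace n es \<sigma> k N w A \<omega> S tt ms
  proof unfold_locales
    fix j assume j: "j < N"
    with \<tau>_take[of j ms] run(2) have "\<tau> (take (Suc j) ms) = script \<sigma> (edges es) (pivot es) (nbr_list es (pivot es)) k N ms ! j"
      by (simp add: \<tau>_def)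
    with tr(2)[OF j] show "exec w (update_prog A) (pass_update (script \<sigma> (edges es) (pivot es) (nbr_list es (pivot es)) k N ms ! j) (S j))
        (tt (Suc j)) (S (Suc j))" by simp
  qed (use tr word run in auto)
  have "t = TT N" unfolding tr(4) TT_def by (simp add: lessThan_Suc_atMost)
  with host_run_total host_correct show ?thesis
    unfolding \<tau>_def by (metis length_cliques)
qed

section \<open>Transfer of the guarantees\<close>

text \<open>No measurability is needed for this direction: scaling acts on the simple functions below \<open>f\<close>.\<close>

lemma nn_integral_cmult_le:
  fixes f :: "'a \<Rightarrow> ennreal"
  assumes C: "0 < C"
  shows "(\<integral>\<^sup>+x. of_nat C * f x \<partial>M) \<le> of_nat C * (\<integral>\<^sup>+x. f x \<partial>M)"
proof -
  define c :: ennreal where "c = of_nat C"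
  have c: "c \<noteq> 0" "c \<noteq> \<top>" using C by (auto simp: c_def)
  have "(\<integral>\<^sup>+x. c * f x \<partial>M) = (SUP g\<in>{g. simple_function M g \<and> g \<le> (\<lambda>x. c * f x)}. integral\<^sup>S M g)"
    by (simp add: nn_integral_def)
  also have "\<dots> \<le> c * (\<integral>\<^sup>+x. f x \<partial>M)"
  proof (rule SUP_least)
    fix g assume "g \<in> {g. simple_function M g \<and> g \<le> (\<lambda>x. c * f x)}"
    then have g: "simple_function M g" "\<And>x. g x \<le> c * f x" by (auto simp: le_fun_def)
    define h where "h x = inverse c * g x" for x
    have h: "simple_function M h" unfolding h_def using g(1) by (intro simple_function_mult) auto
    have "c * inverse c = 1"
      using ennreal_divide_self[of c] c by (simp add: divide_ennreal_def less_top)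
    then have inv: "c * (inverse c * y) = y" "inverse c * (c * y) = y" for y
      by (simp_all flip: mult.assoc) (simp add: mult.commute)
    have "integral\<^sup>S M g = integral\<^sup>S M (\<lambda>x. c * h x)" by (simp add: h_def inv)
    also have "\<dots> = c * integral\<^sup>S M h" by (rule simple_integral_mult[OF h])
    also have "integral\<^sup>S M h \<le> (\<integral>\<^sup>+x. f x \<partial>M)"
    proof -
      have "h x \<le> f x" for x
        using mult_left_mono[OF g(2)[of x], of "inverse c"] by (simp add: h_def inv)
      then show ?thesis
        unfolding nn_integral_def using h by (intro SUP_upper) (auto simp: le_fun_def)
    qed
    finally show "integral\<^sup>S M g \<le> c * (\<integral>\<^sup>+x. f x \<partial>M)" by (simp add: mult_left_mono)
  qed
  finally show ?thesis unfolding c_def .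
qed

text \<open>Without a run of \<open>A\<close> of the required length the right-hand side is
  infinite. Otherwise the infimum is attained at the least step count, and the run attaining it is
  simulated.\<close>

lemma total_time_le:
  assumes "\<And>t s os. run w A n es \<sigma> \<omega> t s os \<Longrightarrow> length os = Suc k \<Longrightarrow>
      \<exists>t' s' os'. run w B n' es' \<sigma>' \<omega> t' s' os' \<and> length os' = Suc k' \<and> t' \<le> C * t"
    and C: "0 < C"
  shows "total_time w B n' es' \<sigma>' \<omega> k' \<le> of_nat C * total_time w A n es \<sigma> \<omega> k"
proof (cases "\<exists>t s os. run w A n es \<sigma> \<omega> t s os \<and> length os = Suc k")
  case False
  then have "total_time w A n es \<sigma> \<omega> k = \<top>" by (auto simp: total_time_def)
  then show ?thesis using C by (simp add: ennreal_mult_top)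
next
  case True
  define T where "T = {t. \<exists>s os. run w A n es \<sigma> \<omega> t s os \<and> length os = Suc k}"
  have "(LEAST t. t \<in> T) \<in> T" using True by (intro LeastI_ex[of "\<lambda>t. t \<in> T"]) (auto simp: T_def)
  then obtain s os where r: "run w A n es \<sigma> \<omega> (LEAST t. t \<in> T) s os" "length os = Suc k"
    by (auto simp: T_def)
  have "of_nat (LEAST t. t \<in> T) \<le> total_time w A n es \<sigma> \<omega> k"
    unfolding total_time_def
  proof (rule Inf_greatest, elim CollectE exE conjE)
    fix x :: ennreal and t s os assume "x = of_nat t" "run w A n es \<sigma> \<omega> t s os" "length os = Suc k"
    then have "t \<in> T" "x = of_nat t" by (auto simp: T_def)
    then show "of_nat (LEAST t. t \<in> T) \<le> x" using Least_le[of "\<lambda>t. t \<in> T" t] by (simp only: of_nat_le_iff)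
  qed
  moreover have "total_time w B n' es' \<sigma>' \<omega> k' \<le> of_nat C * of_nat (LEAST t. t \<in> T)"
  proof -
    from assms(1)[OF r] obtain t' s' os' where
      t': "run w B n' es' \<sigma>' \<omega> t' s' os'" "length os' = Suc k'" "t' \<le> C * (LEAST t. t \<in> T)" by blast
    then have "total_time w B n' es' \<sigma>' \<omega> k' \<le> of_nat t'"
      unfolding total_time_def by (intro Inf_lower) blast
    also have "\<dots> \<le> of_nat (C * (LEAST t. t \<in> T))" using t'(3) by (simp only: of_nat_le_iff)
    finally show ?thesis by simp
  qed
  ultimately show ?thesis by (meson mult_left_mono order_trans zero_le)
qed

text \<open>The simulation works tape by tape, so each guarantee carries over with the same tapes:
  all of them, almost all of them, or the same success event. The failure bound \<open>p n\<close>
  is unchanged because both algorithms have the same \<open>n\<close>.\<close>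

lemma meets_transfer:
  assumes sim: "\<And>\<omega> t s os. run w A n es \<sigma> \<omega> t s os \<Longrightarrow> length os = Suc k \<Longrightarrow>
      \<exists>t' s' os'. run w B n es' \<sigma>' \<omega> t' s' os' \<and> length os' = Suc k' \<and> t' \<le> C * t \<and>
        ((\<forall>i\<le>k. P n (graph_at \<sigma> (edges es) os i) (os ! i)) \<longrightarrow>
         (\<forall>i\<le>k'. P' n (graph_at \<sigma>' (edges es') os' i) (os' ! i)))"
    and C: "0 < C" and A: "meets g P w A n es \<sigma> k b"
  shows "meets g P' w B n es' \<sigma>' k' (real C * b)"
proof -
  have run: "\<exists>t'. correct_run P' w B n es' \<sigma>' \<omega> k' t' \<and> t' \<le> C * t"
    if "correct_run P w A n es \<sigma> \<omega> k t" for \<omega> t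
    using that sim unfolding correct_run_def by blast
  have bounded: "\<exists>t'. correct_run P' w B n es' \<sigma>' \<omega> k' t' \<and> real t' \<le> real C * b"
    if "\<exists>t. correct_run P w A n es \<sigma> \<omega> k t \<and> real t \<le> b" for \<omega>
  proof -
    from that obtain t where t: "correct_run P w A n es \<sigma> \<omega> k t" "real t \<le> b" by blast
    from run[OF t(1)] obtain t' where t': "correct_run P' w B n es' \<sigma>' \<omega> k' t'" "t' \<le> C * t" by blast
    have "real t' \<le> real C * real t" using t'(2) by (simp flip: of_nat_mult)
    also have "\<dots> \<le> real C * b" using t(2) by (intro mult_left_mono) auto
    finally show ?thesis using t'(1) by blast
  qed
  show ?thesis
  proof (cases g)
    case Worst_case
    with A bounded show ?thesis by simp
  next
    case (With_failure p)
    with A obtain E where E: "E \<in> sets (random_tape w)" "measure (random_tape w) E \<ge> 1 - p n"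
      "\<forall>\<omega>\<in>E. \<exists>t. correct_run P w A n es \<sigma> \<omega> k t \<and> real t \<le> b" by auto
    from E(3) bounded have "\<forall>\<omega>\<in>E. \<exists>t. correct_run P' w B n es' \<sigma>' \<omega> k' t \<and> real t \<le> real C * b" by blast
    with E(1,2) show ?thesis unfolding With_failure meets.simps by blast
  next
    case Expected
    have ae: "AE \<omega> in random_tape w. \<exists>t. correct_run P w A n es \<sigma> \<omega> k t"
      and b: "(\<integral>\<^sup>+\<omega>. total_time w A n es \<sigma> \<omega> k \<partial>random_tape w) \<le> ennreal b"
      using A Expected by auto
    from ae have "AE \<omega> in random_tape w. \<exists>t. correct_run P' w B n es' \<sigma>' \<omega> k' t"
      by (rule eventually_mono) (use run in blast)
    moreover have "(\<integral>\<^sup>+\<omega>. total_time w B n es' \<sigma>' \<omega> k' \<partial>random_tape w) \<le> ennreal (real C * b)"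
    proof -
      have "total_time w B n es' \<sigma>' \<omega> k' \<le> of_nat C * total_time w A n es \<sigma> \<omega> k" for \<omega>
        by (rule total_time_le[OF _ C]) (use sim in blast)
      then have "(\<integral>\<^sup>+\<omega>. total_time w B n es' \<sigma>' \<omega> k' \<partial>random_tape w)
          \<le> (\<integral>\<^sup>+\<omega>. of_nat C * total_time w A n es \<sigma> \<omega> k \<partial>random_tape w)"
        by (intro nn_integral_mono)
      also have "\<dots> \<le> of_nat C * (\<integral>\<^sup>+\<omega>. total_time w A n es \<sigma> \<omega> k \<partial>random_tape w)"
        by (rule nn_integral_cmult_le[OF C])
      also have "\<dots> \<le> of_nat C * ennreal b" using b by (intro mult_left_mono) auto
      also have "\<dots> = ennreal (real C * b)" by (simp add: ennreal_mult' flip: ennreal_of_nat_eq_real_of_nat)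
      finally show ?thesis .
    qed
    ultimately show ?thesis using Expected by simp
  qed
qed

lemma maintains_max_clique_host:
  assumes "maintains_MIS a g A T"
  shows "maintains_max_clique a g (host_algorithm A) (\<lambda>n m. real 511 * T n (5 * m))"
proof -
  from assms obtain \<kappa> where \<kappa>: "\<And>w n m \<sigma>. (n + m + 2) ^ \<kappa> \<le> 2 ^ w \<Longrightarrow> of_kind a \<sigma> \<Longrightarrow>
      legal_adversary UNIV n {} m \<sigma> \<Longrightarrow> meets g maximal_indep w A n [] \<sigma> m (T n m)"
    unfolding maintains_MIS_def by blast
  show ?thesis
    unfolding maintains_max_clique_def
  \<comment> \<open>With \<open>x = n + m + 2\<close>, which is at least 2, the guest's size
    \<open>n + 5 * m + 2\<close> is at most \<open>8 * x\<close> and so at most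
    \<open>x ^ 4\<close>. Hence \<open>4 * \<kappa>\<close> serves the guest, and the extra 4 serves
    the host's own arithmetic.\<close>
  proof (intro exI[of _ "4 * \<kappa> + 4"] allI impI, elim conjE)
    fix w n m es k \<sigma>
    assume word: "(n + m + 2) ^ (4 * \<kappa> + 4) \<le> 2 ^ w" and es: "edge_list n es" and m: "length es = m"
      and \<sigma>: "of_kind a \<sigma>" and legal: "legal_adversary deletions n (edges es) k \<sigma>"
    let ?x = "n + m + 2"
    let ?\<tau> = "guest_adversary \<sigma> (edges es) (pivot es) (nbr_list es (pivot es)) k (5 * length es)"
    have "?x ^ 4 \<le> ?x ^ (4 * \<kappa> + 4)" "?x ^ (4 * \<kappa>) \<le> ?x ^ (4 * \<kappa> + 4)"
      by (intro power_increasing; simp)+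
    with word have word4: "?x ^ 4 \<le> 2 ^ w" and "?x ^ (4 * \<kappa>) \<le> 2 ^ w" by linarith+
    moreover have "(n + 5 * m + 2) ^ \<kappa> \<le> ?x ^ (4 * \<kappa>)"
    proof -
      have "n + 5 * m + 2 \<le> 2 ^ 3 * ?x" by simp
      also have "\<dots> \<le> ?x ^ 3 * ?x" by (intro mult_right_mono power_mono) auto
      also have "\<dots> = ?x ^ 4" using power_minus_mult[of 4 ?x] by simp
      finally show ?thesis unfolding power_mult by (intro power_mono) auto
    qed
    ultimately have word\<kappa>: "(n + 5 * m + 2) ^ \<kappa> \<le> 2 ^ w" by linarith
    interpret decremental n es \<sigma> k "5 * length es" by unfold_locales (use es legal in auto)
    have "meets g maximal_indep w A n [] ?\<tau> (5 * m) (T n (5 * m))"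
      by (rule \<kappa>[OF word\<kappa> of_kind_guest_adversary[OF \<sigma>]]) (use legal_\<tau> m in simp)
    then show "meets g maximal_clique w (host_algorithm A) n es \<sigma> k (real 511 * T n (5 * m))"
    proof (rule meets_transfer[rotated 2])
      fix \<omega> t s os
      assume r: "run w A n [] ?\<tau> \<omega> t s os" "length os = Suc (5 * m)"
      from host_simulation[OF es legal _ r(1)] r(2) word4 m
      show "\<exists>t' s' os'. run w (host_algorithm A) n es \<sigma> \<omega> t' s' os' \<and> length os' = Suc k \<and> t' \<le> 511 * t \<and>
        ((\<forall>i\<le>5 * m. maximal_indep n (graph_at ?\<tau> (edges []) os i) (os ! i)) \<longrightarrow>
         (\<forall>i\<le>k. maximal_clique n (graph_at \<sigma> (edges es) os' i) (os' ! i)))"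
        by simp
    qed simp
  qed
qed

theorem theorem5p1:
  fixes A :: dynamic_algorithm and T :: "nat \<Rightarrow> nat \<Rightarrow> real" and g :: guarantee
  assumes "maintains_MIS Oblivious g A T"
  shows "\<exists>(B :: dynamic_algorithm) (C :: nat) (c :: nat).
           maintains_max_clique Oblivious g B (\<lambda>n m. real C * T n (c * m)) \<and>
           (robust_MIS g A T \<longrightarrow> robust_max_clique g B (\<lambda>n m. real C * T n (c * m)))"
  \<comment> \<open>The witness \<open>host_algorithm A\<close> with \<open>C = 511\<close> and
    \<open>c = 5\<close> does not depend on the kind of adversary, so it serves both
    conjuncts.\<close>
  using maintains_max_clique_host assms by blast

end
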